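(* Let $G$ be the graph with vertex set $\{1,2,\dots,10\}$ and edges $\{1,2\},\{1,3\},\{1,4\},\{1,5\},\{2,6\},\{2,7\},\{3,6\},\{3,8\},\{4,7\},\{4,9\},\{5,8\},\{5,9\},\{6,10\},\{7,10\},\{8,10\},\{9,10\}$. Then $\mathcal{H}^{\mathrm{Path}}_2(G)\cong(0)$ and $\mathcal{H}^{\mathrm{Cube}}_2(G)\not\cong(0)$.
   Context: $R$ is a nonzero commutative ring with unit (the coefficient ring). A graph homomorphism is a vertex map sending adjacent vertices to equal or adjacent vertices. $Q_n$ is the graph on $\{0,1\}^n$ with Hamming-distance-one edges ($Q_0$ a single vertex). Discrete cubical homology: a singular $n$-cube is a graph homomorphism $\sigma: Q_n\to G$; $\mathcal{L}^{\mathrm{Cube}}_n(G)$ is the free $R$-module on them. For $n\ge1$, $i\in[n]$: $f_i^{\pm}\sigma(a_1,\dots,a_{n-1})=\sigma(a_1,\dots,a_{i-1},\epsilon,a_i,\dots,a_{n-1})$, $\epsilon=1$ for $+$, $0$ for $-$; $\sigma$ is degenerate if $f_i^+\sigma=f_i^-\sigma$ for some $i$. $\mathcal{C}^{\mathrm{Cube}}_n(G)$ is $\mathcal{L}^{\mathrm{Cube}}_n(G)$ modulo degenerate cubes, $\partial_n\sigma=\sum_{i=1}^n(-1)^i(f_i^-\sigma-f_i^+\sigma)$, $\partial_0=0$; $\mathcal{H}^{\mathrm{Cube}}_n(G)$ is its homology. Path homology: for $V=V(G)$, $\mathcal{C}_n(V)$ is the free $R$-module on $(n+1)$-tuples of vertices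 modulo tuples with $v_i=v_{i+1}$ for some $i$, $\partial_n(v_0,\dots,v_n)=\sum_{i=0}^n(-1)^i(v_0,\dots,\widehat{v_i},\dots,v_n)$, $\partial_0=0$. $\widetilde{\mathcal{C}}_n(G)$ is generated by allowed paths (tuples with $\{v_i,v_{i+1}\}\in E(G)$ for all $i$), $\widetilde{\mathcal{C}}_{-1}=0$; $\mathcal{C}^{\mathrm{Path}}_n(G)=\{x\in\widetilde{\mathcal{C}}_n(G):\partial_nx\in\widetilde{\mathcal{C}}_{n-1}(G)\}$, and $\mathcal{H}^{\mathrm{Path}}_n(G)$ is its homology. *)

theory Defs
  imports
    "HOL-Algebra.Module"
    "HOL-Algebra.AbelCoset"
    "HOL-Library.Poly_Mapping"
    "HOL-Library.FuncSet"
begin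

section \<open>Modules\<close>

text \<open>
  The coefficient ring is a type \<open>'r\<close> of class \<open>comm_ring_1\<close>, i.e. a commutative unital ring
  with \<open>0 \<noteq> 1\<close>. Modules over it are records of HOL-Algebra's type \<open>('r, 'm) module\<close>; the fields
  \<open>mult\<close> and \<open>one\<close>, which that record inherits from rings, play no role.
\<close>

definition module_iso ::
  "('r, 'm, 'x) module_scheme \<Rightarrow> ('r, 'n, 'y) module_scheme \<Rightarrow> ('m \<Rightarrow> 'n) set" where
  "module_iso M N = {h. bij_betw h (carrier M) (carrier N) \<and>
     (\<forall>x\<in>carrier M. \<forall>y\<in>carrier M. h (x \<oplus>\<^bsub>M\<^esub> y) = h x \<oplus>\<^bsub>N\<^esub> h y) \<and>
     (\<forall>c. \<forall>x\<in>carrier M. h (c \<odot>\<^bsub>M\<^esub> x) = c \<odot>\<^bsub>N\<^esub> h x)}"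

definition module_isomorphic ::
  "('r, 'm, 'x) module_scheme \<Rightarrow> ('r, 'n, 'y) module_scheme \<Rightarrow> bool"  (infix \<open>\<cong>\<^sub>M\<close> 50) where
  "M \<cong>\<^sub>M N \<longleftrightarrow> module_iso M N \<noteq> {}"

definition zero_module :: "('r, unit) module" where
  "zero_module = \<lparr>carrier = UNIV, mult = (\<lambda>_ _. ()), one = (), zero = (), add = (\<lambda>_ _. ()),
     smult = (\<lambda>_ _. ())\<rparr>"

definition quotient_module :: "('r, 'm, 'x) module_scheme \<Rightarrow> 'm set \<Rightarrow> ('r, 'm set) module" where
  "quotient_module M N = \<lparr>carrier = a_rcosets\<^bsub>M\<^esub> N, mult = undefined, one = undefined,
     zero = N, add = set_add M, smult = (\<lambda>c X. \<Union>x\<in>X. N +>\<^bsub>M\<^esub> (c \<odot>\<^bsub>M\<^esub> x))\<rparr>"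

text \<open>
  The map \<open>x + N \<mapsto> f x + N'\<close> from a quotient by \<open>N\<close> to the quotient of \<open>M'\<close> by \<open>N'\<close>. The union
  is that single coset whenever \<open>f\<close> is additive and maps \<open>N\<close> into \<open>N'\<close>.
\<close>

definition quotient_map ::
  "('r, 'n, 'x) module_scheme \<Rightarrow> 'n set \<Rightarrow> ('m \<Rightarrow> 'n) \<Rightarrow> 'm set \<Rightarrow> 'n set" where
  "quotient_map M' N' f X = (\<Union>x\<in>X. N' +>\<^bsub>M'\<^esub> f x)"

definition pm_scale :: "'r::comm_ring_1 \<Rightarrow> ('b \<Rightarrow>\<^sub>0 'r) \<Rightarrow> ('b \<Rightarrow>\<^sub>0 'r)" where
  "pm_scale c = Poly_Mapping.map ((*) c)"

definition free_module :: "'b set \<Rightarrow> ('r::comm_ring_1, 'b \<Rightarrow>\<^sub>0 'r) module" where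
  "free_module B = \<lparr>carrier = {x. Poly_Mapping.keys x \<subseteq> B}, mult = undefined, one = undefined,
     zero = 0, add = (+), smult = pm_scale\<rparr>"

definition linear_extension :: "('b \<Rightarrow> ('c \<Rightarrow>\<^sub>0 'r)) \<Rightarrow> ('b \<Rightarrow>\<^sub>0 'r::comm_ring_1) \<Rightarrow> ('c \<Rightarrow>\<^sub>0 'r)" where
  "linear_extension f x = (\<Sum>b\<in>Poly_Mapping.keys x. pm_scale (Poly_Mapping.lookup x b) (f b))"

text \<open>
  Homology of \<open>\<dots> \<rightarrow> C 1 \<rightarrow> C 0\<close> with \<open>d n\<close> mapping \<open>C n\<close> to \<open>C (n - 1)\<close>. The map \<open>d 0\<close>, nominally
  into \<open>C (0 - 1) = C 0\<close>, has to be the zero map.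
\<close>

definition cycles :: "(nat \<Rightarrow> ('r, 'm) module) \<Rightarrow> (nat \<Rightarrow> 'm \<Rightarrow> 'm) \<Rightarrow> nat \<Rightarrow> 'm set" where
  "cycles C d n = {x \<in> carrier (C n). d n x = \<zero>\<^bsub>C (n - 1)\<^esub>}"

definition boundaries :: "(nat \<Rightarrow> ('r, 'm) module) \<Rightarrow> (nat \<Rightarrow> 'm \<Rightarrow> 'm) \<Rightarrow> nat \<Rightarrow> 'm set" where
  "boundaries C d n = d (Suc n) ` carrier (C (Suc n))"

definition homology ::
  "(nat \<Rightarrow> ('r, 'm) module) \<Rightarrow> (nat \<Rightarrow> 'm \<Rightarrow> 'm) \<Rightarrow> nat \<Rightarrow> ('r, 'm set) module" where
  "homology C d n = quotient_module ((C n)\<lparr>carrier := cycles C d n\<rparr>) (boundaries C d n)"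

section \<open>Graphs\<close>

record 'v graph =
  verts :: "'v set"
  edges :: "'v set set"

definition graph_hom :: "'u graph \<Rightarrow> 'v graph \<Rightarrow> ('u \<Rightarrow> 'v) \<Rightarrow> bool" where
  "graph_hom G H f \<longleftrightarrow> f \<in> verts G \<rightarrow> verts H \<and>
     (\<forall>u\<in>verts G. \<forall>v\<in>verts G. {u, v} \<in> edges G \<longrightarrow> f u = f v \<or> {f u, f v} \<in> edges H)"

text \<open>In the hypercube, \<open>True\<close> and \<open>False\<close> stand for the coordinates 1 and 0.\<close>

definition hypercube :: "nat \<Rightarrow> bool list graph" where
  "hypercube n = \<lparr>verts = {a. length a = n},
     edges = {{a, b} | a b. length a = n \<and> length b = n \<and> card {i. i < n \<and> a ! i \<noteq> b ! i} = 1}\<rparr>"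

section \<open>Discrete cubical homology\<close>

text \<open>Cubes are extensional functions, so that they are determined by their values on \<open>Q\<^sub>n\<close>.\<close>

definition singular_cubes :: "'v graph \<Rightarrow> nat \<Rightarrow> (bool list \<Rightarrow> 'v) set" where
  "singular_cubes G n =
     {\<sigma>. graph_hom (hypercube n) G \<sigma> \<and> \<sigma> \<in> extensional (verts (hypercube n))}"

text \<open>\<open>cube_face n i \<epsilon>\<close> is the face map \<open>f\<^sub>i\<^sup>\<epsilon>\<close> on \<open>n\<close>-cubes, where \<open>1 \<le> i \<le> n\<close>.\<close>

definition cube_face :: "nat \<Rightarrow> nat \<Rightarrow> bool \<Rightarrow> (bool list \<Rightarrow> 'v) \<Rightarrow> (bool list \<Rightarrow> 'v)" where
  "cube_face n i \<epsilon> \<sigma> =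
     restrict (\<lambda>a. \<sigma> (take (i - 1) a @ \<epsilon> # drop (i - 1) a)) (verts (hypercube (n - 1)))"

definition degenerate_cubes :: "'v graph \<Rightarrow> nat \<Rightarrow> (bool list \<Rightarrow> 'v) set" where
  "degenerate_cubes G n =
     {\<sigma> \<in> singular_cubes G n. \<exists>i\<in>{1..n}. cube_face n i True \<sigma> = cube_face n i False \<sigma>}"

text \<open>For \<open>n = 0\<close> the sum is empty.\<close>

definition cube_boundary :: "nat \<Rightarrow> (bool list \<Rightarrow> 'v) \<Rightarrow> ((bool list \<Rightarrow> 'v) \<Rightarrow>\<^sub>0 'r::comm_ring_1)" where
  "cube_boundary n \<sigma> = (\<Sum>i = 1..n. pm_scale ((-1) ^ i)
     (Poly_Mapping.single (cube_face n i False \<sigma>) 1 - Poly_Mapping.single (cube_face n i True \<sigma>) 1))"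

definition degenerate_cube_chains ::
  "'v graph \<Rightarrow> nat \<Rightarrow> ((bool list \<Rightarrow> 'v) \<Rightarrow>\<^sub>0 'r::comm_ring_1) set" where
  "degenerate_cube_chains G n = carrier (free_module (degenerate_cubes G n))"

definition cube_chains ::
  "'v graph \<Rightarrow> nat \<Rightarrow> ('r::comm_ring_1, ((bool list \<Rightarrow> 'v) \<Rightarrow>\<^sub>0 'r) set) module" where
  "cube_chains G n = quotient_module (free_module (singular_cubes G n)) (degenerate_cube_chains G n)"

definition cube_chain_boundary ::
  "'v graph \<Rightarrow> nat \<Rightarrow> ((bool list \<Rightarrow> 'v) \<Rightarrow>\<^sub>0 'r::comm_ring_1) set \<Rightarrow>
    ((bool list \<Rightarrow> 'v) \<Rightarrow>\<^sub>0 'r) set" where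
  "cube_chain_boundary G n = quotient_map (free_module (singular_cubes G (n - 1)))
     (degenerate_cube_chains G (n - 1)) (linear_extension (cube_boundary n))"

definition cube_homology ::
  "'r::comm_ring_1 itself \<Rightarrow> 'v graph \<Rightarrow> nat \<Rightarrow>
    ('r, ((bool list \<Rightarrow> 'v) \<Rightarrow>\<^sub>0 'r) set set) module" where
  "cube_homology R G = homology (cube_chains G) (cube_chain_boundary G)"

section \<open>Path homology\<close>

definition vertex_tuples :: "'v set \<Rightarrow> nat \<Rightarrow> 'v list set" where
  "vertex_tuples V n = {p. length p = n + 1 \<and> set p \<subseteq> V}"

definition degenerate_tuples :: "'v set \<Rightarrow> nat \<Rightarrow> 'v list set" where
  "degenerate_tuples V n = {p \<in> vertex_tuples V n. \<exists>i<n. p ! i = p ! Suc i}"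

definition tuple_boundary :: "nat \<Rightarrow> 'v list \<Rightarrow> ('v list \<Rightarrow>\<^sub>0 'r::comm_ring_1)" where
  "tuple_boundary n p = (if n = 0 then 0
     else \<Sum>i = 0..n. Poly_Mapping.single (take i p @ drop (Suc i) p) ((-1) ^ i))"

definition degenerate_tuple_chains :: "'v set \<Rightarrow> nat \<Rightarrow> ('v list \<Rightarrow>\<^sub>0 'r::comm_ring_1) set" where
  "degenerate_tuple_chains V n = carrier (free_module (degenerate_tuples V n))"

definition tuple_chains ::
  "'v set \<Rightarrow> nat \<Rightarrow> ('r::comm_ring_1, ('v list \<Rightarrow>\<^sub>0 'r) set) module" where
  "tuple_chains V n = quotient_module (free_module (vertex_tuples V n)) (degenerate_tuple_chains V n)"

definition tuple_chain_boundary ::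
  "'v set \<Rightarrow> nat \<Rightarrow> ('v list \<Rightarrow>\<^sub>0 'r::comm_ring_1) set \<Rightarrow> ('v list \<Rightarrow>\<^sub>0 'r) set" where
  "tuple_chain_boundary V n = quotient_map (free_module (vertex_tuples V (n - 1)))
     (degenerate_tuple_chains V (n - 1)) (linear_extension (tuple_boundary n))"

definition allowed_paths :: "'v graph \<Rightarrow> nat \<Rightarrow> 'v list set" where
  "allowed_paths G n = {p \<in> vertex_tuples (verts G) n. \<forall>i<n. {p ! i, p ! Suc i} \<in> edges G}"

text \<open>
  The submodule of \<open>tuple_chains (verts G) n\<close> generated by the classes of the allowed paths: the
  image of the free module on the allowed paths.
\<close>

definition allowed_chains :: "'v graph \<Rightarrow> nat \<Rightarrow> ('v list \<Rightarrow>\<^sub>0 'r::comm_ring_1) set set" where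
  "allowed_chains G n =
     (\<lambda>x. degenerate_tuple_chains (verts G) n +>\<^bsub>free_module (vertex_tuples (verts G) n)\<^esub> x)
       ` carrier (free_module (allowed_paths G n))"

text \<open>For \<open>n = 0\<close> the boundary condition is \<open>\<partial>\<^sub>0 x \<in> 0\<close>, which always holds.\<close>

definition path_chains ::
  "'v graph \<Rightarrow> nat \<Rightarrow> ('r::comm_ring_1, ('v list \<Rightarrow>\<^sub>0 'r) set) module" where
  "path_chains G n = (tuple_chains (verts G) n)\<lparr>carrier := {x \<in> allowed_chains G n.
     n = 0 \<or> tuple_chain_boundary (verts G) n x \<in> allowed_chains G (n - 1)}\<rparr>"

definition path_homology ::
  "'r::comm_ring_1 itself \<Rightarrow> 'v graph \<Rightarrow> nat \<Rightarrow> ('r, ('v list \<Rightarrow>\<^sub>0 'r) set set) module" where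
  "path_homology R G = homology (path_chains G) (tuple_chain_boundary (verts G))"

section \<open>The example graph\<close>

definition example_graph :: "nat graph" where
  "example_graph = \<lparr>verts = {1..10},
     edges = {{1,2}, {1,3}, {1,4}, {1,5}, {2,6}, {2,7}, {3,6}, {3,8}, {4,7}, {4,9}, {5,8}, {5,9},
       {6,10}, {7,10}, {8,10}, {9,10}}\<rparr>"

end

(*
  The graph is the 1-skeleton of a sphere tiled by eight squares.

  Path homology: modulo boundaries a spike (u, v, u) can be reversed and a square (a, b, c) - (a, d, c)
  can be rotated, so every 2-cycle reduces to a combination of upward spikes and of one upward square
  per face of the sphere. The alternating sum of the eight shortest paths from 1 to 10 has the sum of
  these squares as its boundary, which eliminates one of them, and the boundaries of the remaining
  generators are linearly independent.

  Cubical homology: the degree of a singular 2-cube over one of the squares is a cochain that takes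
  the value 1 on the sphere. Up to a coboundary, eight times this degree is the degree over all
  squares together, which is at most 1 in absolute value on each 2-cube. A 3-cube has only six
  faces, so the degree of its boundary is an integer of absolute value at most 6/8.
*)
theory Submission
  imports Defs
begin

section \<open>Chains with prescribed support\<close>

text \<open>The middle vertices of the shortest paths from 1 to 10 form the octagon 2, 6, 3, 8, 5,
  9, 4, 7. The alternating sum of paths closes up around a cycle of any even length, whereas the
  paths between opposite corners of a 3-cube use a hexagon. This is where the two theories part: the
  surface of a cube, six squares, is the boundary of one 3-cube, so the estimate of the degree
  requires more than six squares. That estimate makes sense for integers only; the degree of a
  boundary is therefore shown to vanish over the integers and mapped to the coefficient ring
  afterwards. On the path side, spikes and squares suffice because the graph has no triangles and
  two distinct vertices have at most two common neighbours. The equations that give linear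
  independence can be solved one unknown at a time with pivots 1 and -1, so no division occurs and
  any coefficient ring is covered. The computations use representatives in free modules; the
  quotients enter at the end of each half.\<close>

lemma lookup_pm_scale [simp]: "Poly_Mapping.lookup (pm_scale c x) k = c * Poly_Mapping.lookup x k"
  by (simp add: pm_scale_def map.rep_eq when_def)

lemma pm_scale_single [simp]: "pm_scale c (Poly_Mapping.single b r) = Poly_Mapping.single b (c * r)"
  by (rule poly_mapping_eqI) (simp add: lookup_single when_def)

lemma pm_scale_one [simp]: "pm_scale 1 x = x"
  by (rule poly_mapping_eqI) simp

lemma pm_scale_minus_one: "pm_scale (- 1) x = - x"
  by (rule poly_mapping_eqI) simp

lemma pm_scale_zero [simp]: "pm_scale 0 x = 0" "pm_scale c 0 = 0"
  by (rule poly_mapping_eqI; simp)+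

lemma pm_scale_add: "pm_scale c (x + y) = pm_scale c x + pm_scale c y"
  by (rule poly_mapping_eqI) (simp add: lookup_add algebra_simps)

lemma pm_scale_diff: "pm_scale c (x - y) = pm_scale c x - pm_scale c y"
  by (rule poly_mapping_eqI) (simp add: lookup_minus algebra_simps)

lemma pm_scale_sum: "pm_scale c (sum f A) = (\<Sum>a\<in>A. pm_scale c (f a))"
  by (rule poly_mapping_eqI) (simp add: lookup_sum sum_distrib_left)

text \<open>Chains, degenerate chains and allowed chains are all spanned by sets of basis elements,
  so this one predicate stands for each of these submodules.\<close>

definition supported :: "'b set \<Rightarrow> ('b \<Rightarrow>\<^sub>0 'r::comm_ring_1) set" where
  "supported B = {x. Poly_Mapping.keys x \<subseteq> B}"

lemma supported_iff: "x \<in> supported B \<longleftrightarrow> (\<forall>b. b \<notin> B \<longrightarrow> Poly_Mapping.lookup x b = 0)"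
  by (auto simp: supported_def in_keys_iff)

lemma carrier_free_module: "carrier (free_module B) = supported B"
  by (simp add: free_module_def supported_def)

lemma supported_0 [simp]: "0 \<in> supported B"
  by (simp add: supported_iff)

lemma supported_add [intro]: "x \<in> supported B \<Longrightarrow> y \<in> supported B \<Longrightarrow> x + y \<in> supported B"
  by (simp add: supported_iff lookup_add)

lemma supported_diff [intro]: "x \<in> supported B \<Longrightarrow> y \<in> supported B \<Longrightarrow> x - y \<in> supported B"
  by (simp add: supported_iff lookup_minus)

lemma supported_uminus [simp]: "- x \<in> supported B \<longleftrightarrow> x \<in> supported B"
  by (simp add: supported_iff)

lemma supported_scale [intro]: "x \<in> supported B \<Longrightarrow> pm_scale c x \<in> supported B"
  by (simp add: supported_iff)

lemma supported_single [simp]: "Poly_Mapping.single b r \<in> supported B \<longleftrightarrow> b \<in> B \<or> r = 0"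
  by (auto simp: supported_iff lookup_single when_def)

lemma supported_sum [intro]: "(\<And>a. a \<in> A \<Longrightarrow> f a \<in> supported B) \<Longrightarrow> sum f A \<in> supported B"
  by (induction A rule: infinite_finite_induct) auto

lemma lookup_linear_extension:
  assumes "finite A" "Poly_Mapping.keys x \<subseteq> A"
  shows "Poly_Mapping.lookup (linear_extension f x) c =
    (\<Sum>b\<in>A. Poly_Mapping.lookup x b * Poly_Mapping.lookup (f b) c)"
  unfolding linear_extension_def lookup_sum lookup_pm_scale
  using assms by (intro sum.mono_neutral_left) (auto simp: in_keys_iff)

lemma linear_extension_add: "linear_extension f (x + y) = linear_extension f x + linear_extension f y"
proof (rule poly_mapping_eqI)
  fix c
  let ?A = "Poly_Mapping.keys x \<union> Poly_Mapping.keys y"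
  show "Poly_Mapping.lookup (linear_extension f (x + y)) c =
    Poly_Mapping.lookup (linear_extension f x + linear_extension f y) c"
    using keys_add[of x y]
    by (simp add: lookup_add lookup_linear_extension[of ?A] sum.distrib distrib_right)
qed

lemma linear_extension_single [simp]: "linear_extension f (Poly_Mapping.single b r) = pm_scale r (f b)"
  by (cases "r = 0") (simp_all add: linear_extension_def)

lemma linear_extension_zero [simp]: "linear_extension f 0 = 0"
  by (simp add: linear_extension_def)

lemma linear_extension_uminus: "linear_extension f (- x) = - linear_extension f x"
  using linear_extension_add[of f "- x" x] by (simp add: eq_neg_iff_add_eq_0)

lemma linear_extension_diff: "linear_extension f (x - y) = linear_extension f x - linear_extension f y"
  using linear_extension_add[of f x "- y"] by (simp add: linear_extension_uminus)

lemma linear_extension_sum: "linear_extension f (sum g A) = (\<Sum>a\<in>A. linear_extension f (g a))"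
  by (induction A rule: infinite_finite_induct) (simp_all add: linear_extension_add)

lemma linear_extension_scale: "linear_extension f (pm_scale c x) = pm_scale c (linear_extension f x)"
proof (rule poly_mapping_eqI)
  fix k
  have "Poly_Mapping.keys (pm_scale c x) \<subseteq> Poly_Mapping.keys x"
    by (auto simp: in_keys_iff)
  then show "Poly_Mapping.lookup (linear_extension f (pm_scale c x)) k =
    Poly_Mapping.lookup (pm_scale c (linear_extension f x)) k"
    by (simp add: lookup_linear_extension[of "Poly_Mapping.keys x"] sum_distrib_left mult.assoc)
qed

lemma linear_extension_supported:
  assumes "x \<in> supported A" "\<And>b. b \<in> A \<Longrightarrow> f b \<in> supported B"
  shows "linear_extension f x \<in> supported B"
  using assms unfolding linear_extension_def supported_def[of A] by auto

lemma linear_extension_linear_extension: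
  "linear_extension g (linear_extension f x) = linear_extension (\<lambda>b. linear_extension g (f b)) x"
  by (simp add: linear_extension_def[of f] linear_extension_def[of "\<lambda>b. linear_extension g (f b)"]
      linear_extension_sum linear_extension_scale)

section \<open>Cosets\<close>

definition coset :: "('b \<Rightarrow>\<^sub>0 'r::comm_ring_1) set \<Rightarrow> ('b \<Rightarrow>\<^sub>0 'r) \<Rightarrow> ('b \<Rightarrow>\<^sub>0 'r) set" where
  "coset N x = {y. y - x \<in> N}"

lemma r_coset_free_module: "N +>\<^bsub>free_module A\<^esub> x = coset N x"
proof -
  have "(\<exists>h\<in>N. y = h + x) \<longleftrightarrow> y - x \<in> N" for y
    by (metis add_diff_cancel_right' diff_add_cancel)
  then show ?thesis
    by (auto simp: a_r_coset_def' free_module_def coset_def)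
qed

lemma coset_self [simp]: "x \<in> coset (supported B) x"
  by (simp add: coset_def)

lemma coset_eq_iff: "coset (supported B) x = coset (supported B) y \<longleftrightarrow> x - y \<in> supported B"
proof
  assume "coset (supported B) x = coset (supported B) y"
  then have "x \<in> coset (supported B) y"
    using coset_self by metis
  then show "x - y \<in> supported B"
    by (simp add: coset_def)
next
  assume *: "x - y \<in> supported B"
  have "z - x \<in> supported B \<longleftrightarrow> z - y \<in> supported B" for z
    using supported_add[OF _ *, of "z - x"] supported_diff[OF _ *, of "z - y"] by auto
  then show "coset (supported B) x = coset (supported B) y"
    by (simp add: coset_def)
qed

lemma coset_0: "coset (supported B) 0 = supported B"
  by (simp add: coset_def)

lemma quotient_module_carrier:
  "carrier (quotient_module (free_module A) N) = coset N ` supported A"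
  by (auto simp: quotient_module_def A_RCOSETS_def' r_coset_free_module carrier_free_module)

lemma quotient_module_add:
  "coset (supported B) x \<oplus>\<^bsub>quotient_module (free_module A) N\<^esub> coset (supported B) y =
     coset (supported B) (x + y)"
proof -
  have "(\<exists>u. u - x \<in> supported B \<and> (\<exists>v. v - y \<in> supported B \<and> z = u + v)) \<longleftrightarrow>
    z - (x + y) \<in> supported B" for z
  proof
    assume "\<exists>u. u - x \<in> supported B \<and> (\<exists>v. v - y \<in> supported B \<and> z = u + v)"
    then obtain u v where "u - x \<in> supported B" "v - y \<in> supported B" "z = u + v"
      by blast
    then show "z - (x + y) \<in> supported B"
      using supported_add[of "u - x" B "v - y"] by (simp add: algebra_simps)
  next
    assume "z - (x + y) \<in> supported B"
    then show "\<exists>u. u - x \<in> supported B \<and> (\<exists>v. v - y \<in> supported B \<and> z = u + v)"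
      by (intro exI[of _ "z - y"] conjI exI[of _ y]) (simp_all add: algebra_simps)
  qed
  then show ?thesis
    by (auto simp: quotient_module_def set_add_def' coset_def free_module_def)
qed

text \<open>Two representatives differ by an element of \<open>supported B\<close>, which is sent
  into \<open>supported B'\<close>. Hence the union in \<open>quotient_map\<close> collapses to one
  coset, and it suffices to check \<open>f\<close> on basis elements.\<close>

lemma quotient_map_coset:
  assumes "\<And>b. b \<in> B \<Longrightarrow> f b \<in> supported B'"
  shows "quotient_map (free_module A') (supported B') (linear_extension f) (coset (supported B) x) =
    coset (supported B') (linear_extension f x)"
proof -
  have "coset (supported B') (linear_extension f y) = coset (supported B') (linear_extension f x)"
    if "y \<in> coset (supported B) x" for y
  proof -
    have "linear_extension f (y - x) \<in> supported B'"
      using that assms by (intro linear_extension_supported[of _ B]) (simp_all add: coset_def)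
    then show ?thesis
      by (simp add: coset_eq_iff linear_extension_diff)
  qed
  then have "(\<Union>y\<in>coset (supported B) x. coset (supported B') (linear_extension f y)) =
      (\<Union>y\<in>coset (supported B) x. coset (supported B') (linear_extension f x))"
    by (intro SUP_cong refl)
  moreover have "coset (supported B) x \<noteq> {}"
    using coset_self[of x B] by blast
  ultimately show ?thesis
    by (simp add: quotient_map_def r_coset_free_module)
qed

lemma carrier_homology:
  "carrier (homology C d n) =
    (\<lambda>x. (\<lambda>b. b \<oplus>\<^bsub>C n\<^esub> x) ` boundaries C d n) ` cycles C d n"
  by (auto simp: homology_def quotient_module_def A_RCOSETS_def' a_r_coset_def')

text \<open>Into a one-point target the compatibility conditions of \<open>module_iso\<close> hold
  trivially, so vanishing of homology becomes a question about the carrier alone.\<close>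

lemma singleton_carrier_isomorphic_zero:
  fixes M :: "('r, 'm, 'x) module_scheme"
  assumes "carrier M = {z}"
  shows "M \<cong>\<^sub>M (zero_module :: ('r, unit) module)"
proof -
  have "(\<lambda>_. ()) \<in> module_iso M (zero_module :: ('r, unit) module)"
    using assms by (simp add: module_iso_def zero_module_def bij_betw_def UNIV_unit)
  then show ?thesis
    unfolding module_isomorphic_def by blast
qed

lemma isomorphic_zero_carrier_unique:
  fixes M :: "('r, 'm, 'x) module_scheme"
  assumes "M \<cong>\<^sub>M (zero_module :: ('r, unit) module)" "x \<in> carrier M" "y \<in> carrier M"
  shows "x = y"
proof -
  obtain h where "h \<in> module_iso M (zero_module :: ('r, unit) module)"
    using assms(1) unfolding module_isomorphic_def by blast
  then have "bij_betw h (carrier M) (carrier (zero_module :: ('r, unit) module))"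
    unfolding module_iso_def by blast
  then have "inj_on h (carrier M)"
    by (rule bij_betw_imp_inj_on)
  moreover have "h x = h y"
    by simp
  ultimately show ?thesis
    using assms(2,3) by (rule inj_onD)
qed

section \<open>The example graph\<close>

definition nbrs :: "nat \<Rightarrow> nat set" where
  "nbrs u = {v. {u, v} \<in> edges example_graph}"

lemma edge_iff: "{u, v} \<in> edges example_graph \<longleftrightarrow> v \<in> nbrs u"
  by (simp add: nbrs_def)

text \<open>The equation for \<open>Suc 0\<close> repeats the one for 1, because simplification may
  turn \<open>1\<close> into \<open>Suc 0\<close>.\<close>

lemma nbrs_eq:
  "nbrs 1 = {2, 3, 4, 5}" "nbrs 2 = {1, 6, 7}" "nbrs 3 = {1, 6, 8}" "nbrs 4 = {1, 7, 9}"
  "nbrs 5 = {1, 8, 9}" "nbrs 6 = {2, 3, 10}" "nbrs 7 = {2, 4, 10}" "nbrs 8 = {3, 5, 10}"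
  "nbrs 9 = {4, 5, 10}" "nbrs 10 = {6, 7, 8, 9}" "nbrs (Suc 0) = {2, 3, 4, 5}"
  by (auto simp: nbrs_def example_graph_def doubleton_eq_iff)

lemma nbrs_sym: "v \<in> nbrs u \<longleftrightarrow> u \<in> nbrs v"
  by (simp add: nbrs_def insert_commute)

abbreviation V :: "nat set" where "V \<equiv> verts example_graph"

lemma verts_example: "V = {1..10}"
  by (simp add: example_graph_def)

lemma vertex_cases:
  "u \<in> V \<Longrightarrow> u = 1 \<or> u = 2 \<or> u = 3 \<or> u = 4 \<or> u = 5 \<or> u = 6 \<or> u = 7 \<or> u = 8 \<or> u = 9 \<or> u = 10"
  by (auto simp: verts_example atLeastAtMostSuc_conv numeral_eq_Suc)

lemma nbrs_verts: "v \<in> nbrs u \<Longrightarrow> u \<in> V \<and> v \<in> V"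
  by (auto simp: nbrs_def example_graph_def doubleton_eq_iff)

section \<open>Path homology\<close>

lemma length_2_iff: "length p = 2 \<longleftrightarrow> (\<exists>a b. p = [a, b])"
  by (auto simp: numeral_2_eq_2 length_Suc_conv)

lemma length_3_iff: "length p = 3 \<longleftrightarrow> (\<exists>a b c. p = [a, b, c])"
  by (auto simp: numeral_3_eq_3 length_Suc_conv)

lemma length_4_iff: "length p = 4 \<longleftrightarrow> (\<exists>a b c d. p = [a, b, c, d])"
  by (auto simp: numeral_eq_Suc length_Suc_conv)

lemma All_less_2: "(\<forall>i<2. P i) \<longleftrightarrow> P 0 \<and> P (Suc 0)"
  by (auto simp: numeral_2_eq_2 less_Suc_eq)

lemma All_less_3: "(\<forall>i<3. P i) \<longleftrightarrow> P 0 \<and> P (Suc 0) \<and> P (Suc (Suc 0))"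
  by (auto simp: numeral_3_eq_3 less_Suc_eq)

lemma Ex_less_2: "(\<exists>i<2. P i) \<longleftrightarrow> P 0 \<or> P (Suc 0)"
  using All_less_2[of "\<lambda>i. \<not> P i"] by blast

lemma Ex_less_3: "(\<exists>i<3. P i) \<longleftrightarrow> P 0 \<or> P (Suc 0) \<or> P (Suc (Suc 0))"
  using All_less_3[of "\<lambda>i. \<not> P i"] by blast

lemma allowed_paths_2: "[a, b, c] \<in> allowed_paths example_graph 2 \<longleftrightarrow> b \<in> nbrs a \<and> c \<in> nbrs b"
  by (auto simp: allowed_paths_def vertex_tuples_def All_less_2 edge_iff dest: nbrs_verts)

lemma allowed_paths_3:
  "[a, b, c, d] \<in> allowed_paths example_graph 3 \<longleftrightarrow> b \<in> nbrs a \<and> c \<in> nbrs b \<and> d \<in> nbrs c"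
  by (auto simp: allowed_paths_def vertex_tuples_def All_less_3 edge_iff dest: nbrs_verts)

lemma degenerate_tuples_1: "[a, b] \<in> degenerate_tuples U 1 \<longleftrightarrow> a \<in> U \<and> b = a"
  by (auto simp: degenerate_tuples_def vertex_tuples_def)

lemma degenerate_tuples_2:
  "[a, b, c] \<in> degenerate_tuples U 2 \<longleftrightarrow> a \<in> U \<and> b \<in> U \<and> c \<in> U \<and> (a = b \<or> b = c)"
  by (auto simp: degenerate_tuples_def vertex_tuples_def Ex_less_2)

lemma tuple_boundary_2:
  "tuple_boundary 2 [a, b, c] =
    Poly_Mapping.single [b, c] 1 - Poly_Mapping.single [a, c] 1 + Poly_Mapping.single [a, b] 1"
  by (simp add: tuple_boundary_def numeral_2_eq_2 single_uminus)

lemma tuple_boundary_3: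
  "tuple_boundary 3 [a, b, c, d] =
    Poly_Mapping.single [b, c, d] 1 - Poly_Mapping.single [a, c, d] 1 +
    Poly_Mapping.single [a, b, d] 1 - Poly_Mapping.single [a, b, c] 1"
  by (simp add: tuple_boundary_def numeral_3_eq_3 single_uminus)

lemma tuple_boundary_2_degenerate:
  assumes "p \<in> degenerate_tuples U 2"
  shows "tuple_boundary 2 p \<in> supported (degenerate_tuples U 1)"
proof -
  obtain a b c where p: "p = [a, b, c]"
    using assms by (auto simp: degenerate_tuples_def vertex_tuples_def length_3_iff)
  then have U: "a \<in> U" "b \<in> U" "c \<in> U" and "a = b \<or> b = c"
    using assms by (simp_all add: degenerate_tuples_2)
  then show ?thesis
    unfolding p tuple_boundary_2 by (elim disjE) (simp_all add: degenerate_tuples_1 del: One_nat_def)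
qed

lemma tuple_boundary_3_degenerate:
  assumes "p \<in> degenerate_tuples U 3"
  shows "tuple_boundary 3 p \<in> supported (degenerate_tuples U 2)"
proof -
  obtain a b c d where p: "p = [a, b, c, d]"
    using assms by (auto simp: degenerate_tuples_def vertex_tuples_def length_4_iff)
  then have U: "a \<in> U" "b \<in> U" "c \<in> U" "d \<in> U" and "a = b \<or> b = c \<or> c = d"
    using assms by (auto simp: degenerate_tuples_def vertex_tuples_def Ex_less_3)
  then consider "a = b" | "b = c" | "c = d"
    by blast
  then show ?thesis
    unfolding p tuple_boundary_3
    by cases (use U in \<open>simp_all add: degenerate_tuples_2 supported_add supported_diff\<close>)
qed

lemma tuple_boundary_boundary:
  assumes "length p = 4"
  shows "linear_extension (tuple_boundary 2) (tuple_boundary 3 p) = 0"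
  using assms by (auto simp: length_4_iff tuple_boundary_2 tuple_boundary_3
      linear_extension_add linear_extension_diff)

text \<open>The condition that the boundary of \<open>y\<close> be allowed is left out: for an
  allowed \<open>x\<close> it is automatic, since that boundary then agrees with \<open>x\<close> up
  to degenerate tuples.\<close>

definition bounding :: "(nat list \<Rightarrow>\<^sub>0 'r::comm_ring_1) set" where
  "bounding = {x. \<exists>y\<in>supported (allowed_paths example_graph 3).
     x - linear_extension (tuple_boundary 3) y \<in> supported (degenerate_tuples V 2)}"

lemma boundingI:
  assumes "y \<in> supported (allowed_paths example_graph 3)"
    and "x = linear_extension (tuple_boundary 3) y + z" "z \<in> supported (degenerate_tuples V 2)"
  shows "x \<in> bounding"
  unfolding bounding_def mem_Collect_eq using assms(2,3) by (intro bexI[OF _ assms(1)]) simp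

lemma boundingE:
  assumes "x \<in> bounding"
  obtains y z where "y \<in> supported (allowed_paths example_graph 3)"
    and "x = linear_extension (tuple_boundary 3) y + z" "z \<in> supported (degenerate_tuples V 2)"
proof -
  obtain y where "y \<in> supported (allowed_paths example_graph 3)"
    "x - linear_extension (tuple_boundary 3) y \<in> supported (degenerate_tuples V 2)"
    using assms by (auto simp: bounding_def)
  then show thesis
    by (intro that[of y "x - linear_extension (tuple_boundary 3) y"]) simp_all
qed

lemma bounding_0: "0 \<in> bounding"
  by (rule boundingI[of 0 _ 0]) simp_all

lemma bounding_add:
  assumes "x \<in> bounding" "x' \<in> bounding"
  shows "x + x' \<in> bounding"
proof -
  obtain y z y' z' where *: "y \<in> supported (allowed_paths example_graph 3)"
    "z \<in> supported (degenerate_tuples V 2)" "y' \<in> supported (allowed_paths example_graph 3)"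
    "z' \<in> supported (degenerate_tuples V 2)"
    and "x = linear_extension (tuple_boundary 3) y + z"
    "x' = linear_extension (tuple_boundary 3) y' + z'"
    using assms by (elim boundingE)
  then show ?thesis
    by (intro boundingI[OF supported_add[OF *(1,3)] _ supported_add[OF *(2,4)]])
      (simp add: linear_extension_add)
qed

lemma bounding_scale:
  assumes "x \<in> bounding"
  shows "pm_scale c x \<in> bounding"
proof -
  obtain y z where *: "y \<in> supported (allowed_paths example_graph 3)"
    "z \<in> supported (degenerate_tuples V 2)" and "x = linear_extension (tuple_boundary 3) y + z"
    using assms by (elim boundingE)
  then show ?thesis
    by (intro boundingI[OF supported_scale[OF *(1)] _ supported_scale[OF *(2)]])
      (simp add: linear_extension_scale pm_scale_add)
qed

text \<open>The path \<open>[u, v, u, v]\<close> has the two spikes as outer faces, with opposite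
  signs, and degenerate inner faces.\<close>

lemma bounding_swap:
  assumes "v \<in> nbrs u"
  shows "Poly_Mapping.single [v, u, v] 1 - Poly_Mapping.single [u, v, u] 1 \<in> bounding"
proof (rule boundingI)
  show "Poly_Mapping.single [u, v, u, v] 1 \<in> supported (allowed_paths example_graph 3)"
    using assms by (simp add: allowed_paths_3 nbrs_sym[of u v])
  show "Poly_Mapping.single [v, u, v] 1 - Poly_Mapping.single [u, v, u] 1 =
      linear_extension (tuple_boundary 3) (Poly_Mapping.single [u, v, u, v] 1) +
      (Poly_Mapping.single [u, u, v] 1 - Poly_Mapping.single [u, v, v] 1)"
    by (simp add: tuple_boundary_3)
  show "Poly_Mapping.single [u, u, v] 1 - Poly_Mapping.single [u, v, v] 1
      \<in> supported (degenerate_tuples V 2)"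
    using nbrs_verts[OF assms] by (simp add: degenerate_tuples_2 supported_diff)
qed

text \<open>The face \<open>[a, c]\<close> occurs in both boundaries and drops out of the
  difference. For a quadrilateral of this graph it is not an edge, so neither path alone would be a
  path chain.\<close>

definition path_square :: "nat \<Rightarrow> nat \<Rightarrow> nat \<Rightarrow> nat \<Rightarrow> (nat list \<Rightarrow>\<^sub>0 'r::comm_ring_1)" where
  "path_square a b c d = Poly_Mapping.single [a, b, c] 1 - Poly_Mapping.single [a, d, c] 1"

lemma bounding_rotate:
  assumes "b \<in> nbrs a" "c \<in> nbrs b" "d \<in> nbrs c" "a \<in> nbrs d"
  shows "path_square a b c d - path_square b c d a - Poly_Mapping.single [a, b, a] 1
    + Poly_Mapping.single [d, c, d] 1 \<in> bounding"
proof (rule boundingI)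
  \<comment> \<open>The inner faces \<open>[a, c, d]\<close> and \<open>[a, b, d]\<close> of
    \<open>[a, b, c, d]\<close> need not be allowed. The two spiked paths are chosen to cancel them;
    their other inner faces are degenerate and make up \<open>?z\<close>.\<close>
  let ?y = "Poly_Mapping.single [a, d, c, d] 1 + Poly_Mapping.single [a, b, a, d] 1
          - Poly_Mapping.single [a, b, c, d] 1 :: nat list \<Rightarrow>\<^sub>0 'a"
  let ?z = "Poly_Mapping.single [a, a, d] 1 - Poly_Mapping.single [a, d, d] 1 :: nat list \<Rightarrow>\<^sub>0 'a"
  have "d \<in> nbrs a" "a \<in> nbrs b" "c \<in> nbrs d"
    using assms by (simp_all add: nbrs_sym[of a b] nbrs_sym[of a d] nbrs_sym[of c d])
  with assms show "?y \<in> supported (allowed_paths example_graph 3)"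
    by (simp add: allowed_paths_3 supported_add supported_diff)
  show "path_square a b c d - path_square b c d a - Poly_Mapping.single [a, b, a] 1
      + Poly_Mapping.single [d, c, d] 1 = linear_extension (tuple_boundary 3) ?y + ?z"
    by (simp add: path_square_def tuple_boundary_3 linear_extension_diff linear_extension_add)
  show "?z \<in> supported (degenerate_tuples V 2)"
    using nbrs_verts[OF assms(4)] by (simp add: degenerate_tuples_2 supported_diff)
qed

text \<open>
  The inner faces \<open>(1, b, 10)\<close> and \<open>(1, a, 10)\<close> of these paths \<open>(1, a, b, 10)\<close> cancel in pairs, and the
  outer faces add up to the eight squares of the sphere.
\<close>

abbreviation paths_1_10 :: "nat list \<Rightarrow>\<^sub>0 'r::comm_ring_1" where
  "paths_1_10 \<equiv>
    Poly_Mapping.single [1, 3, 6, 10] 1 - Poly_Mapping.single [1, 2, 6, 10] 1 +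
    Poly_Mapping.single [1, 5, 8, 10] 1 - Poly_Mapping.single [1, 3, 8, 10] 1 +
    Poly_Mapping.single [1, 4, 9, 10] 1 - Poly_Mapping.single [1, 5, 9, 10] 1 +
    Poly_Mapping.single [1, 2, 7, 10] 1 - Poly_Mapping.single [1, 4, 7, 10] 1"

lemma bounding_sphere:
  "path_square 1 2 6 3 + path_square 1 3 8 5 + path_square 1 5 9 4 + path_square 1 4 7 2 +
   path_square 2 7 10 6 + path_square 3 6 10 8 + path_square 5 8 10 9 + path_square 4 9 10 7
   \<in> bounding"
proof (rule boundingI[of _ _ 0])
  show "paths_1_10 \<in> supported (allowed_paths example_graph 3)"
    by (simp add: allowed_paths_3 nbrs_eq supported_add supported_diff del: One_nat_def)
qed (simp_all add: path_square_def tuple_boundary_3 linear_extension_diff linear_extension_add)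

section \<open>Normal forms of 2-chains modulo boundaries\<close>

definition sphere_edges :: "nat list set" where
  "sphere_edges = {[1, 2], [1, 3], [1, 4], [1, 5], [2, 6], [2, 7], [3, 6], [3, 8], [4, 7], [4, 9],
     [5, 8], [5, 9], [6, 10], [7, 10], [8, 10], [9, 10]}"

text \<open>The square 1, 2, 6, 3 is left out. Like the edges above, squares are written upwards,
  with \<open>a < b < c\<close> and \<open>a < d < c\<close>; their boundaries therefore involve
  ascending pairs only, which \<open>normal_form_cycle\<close> exploits.\<close>

definition punctured_squares :: "nat list set" where
  "punctured_squares = {[1, 3, 8, 5], [1, 5, 9, 4], [1, 4, 7, 2], [2, 7, 10, 6], [3, 6, 10, 8],
     [5, 8, 10, 9], [4, 9, 10, 7]}"

text \<open>Keys of length two encode spikes and keys of length four encode squares, so that one sum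
  over keys covers both kinds.\<close>

fun normal_generator :: "nat list \<Rightarrow> (nat list \<Rightarrow>\<^sub>0 'r::comm_ring_1)" where
  "normal_generator [u, v] = Poly_Mapping.single [u, v, u] 1"
| "normal_generator [a, b, c, d] = path_square a b c d"
| "normal_generator _ = 0"

definition normal_form :: "(nat list \<Rightarrow> 'r) \<Rightarrow> (nat list \<Rightarrow>\<^sub>0 'r::comm_ring_1)" where
  "normal_form f = (\<Sum>p\<in>sphere_edges \<union> punctured_squares. pm_scale (f p) (normal_generator p))"

definition reducible :: "(nat list \<Rightarrow>\<^sub>0 'r::comm_ring_1) set" where
  "reducible = {x. \<exists>f. x - normal_form f \<in> bounding}"

lemma reducible_0: "0 \<in> reducible"
  using bounding_0 by (auto simp: reducible_def normal_form_def intro!: exI[of _ "\<lambda>_. 0"])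

lemma reducible_add:
  assumes "x \<in> reducible" "y \<in> reducible"
  shows "x + y \<in> reducible"
proof -
  obtain f g where "x - normal_form f \<in> bounding" "y - normal_form g \<in> bounding"
    using assms by (auto simp: reducible_def)
  then have "(x - normal_form f) + (y - normal_form g) \<in> bounding"
    by (rule bounding_add)
  moreover have "normal_form (\<lambda>p. f p + g p) = normal_form f + normal_form g"
    unfolding normal_form_def sum.distrib[symmetric]
    by (intro sum.cong refl poly_mapping_eqI) (simp add: lookup_add distrib_right)
  ultimately show ?thesis
    unfolding reducible_def by (auto intro!: exI[of _ "\<lambda>p. f p + g p"] simp: algebra_simps)
qed

lemma reducible_scale:
  assumes "x \<in> reducible"
  shows "pm_scale c x \<in> reducible"
proof -
  obtain f where "x - normal_form f \<in> bounding"
    using assms by (auto simp: reducible_def)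
  then have "pm_scale c (x - normal_form f) \<in> bounding"
    by (rule bounding_scale)
  moreover have "normal_form (\<lambda>p. c * f p) = pm_scale c (normal_form f)"
    unfolding normal_form_def pm_scale_sum
    by (intro sum.cong refl poly_mapping_eqI) (simp add: mult.assoc)
  ultimately show ?thesis
    unfolding reducible_def by (auto intro!: exI[of _ "\<lambda>p. c * f p"] simp: pm_scale_diff)
qed

lemma reducible_uminus: "- x \<in> reducible \<longleftrightarrow> x \<in> reducible"
  using reducible_scale[of x "- 1"] reducible_scale[of "- x" "- 1"] by (auto simp: pm_scale_minus_one)

lemma reducible_diff: "x \<in> reducible \<Longrightarrow> y \<in> reducible \<Longrightarrow> x - y \<in> reducible"
  using reducible_add[of x "- y"] by (simp add: reducible_uminus)

lemma reducible_sum: "(\<And>a. a \<in> A \<Longrightarrow> f a \<in> reducible) \<Longrightarrow> sum f A \<in> reducible"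
  by (induction A rule: infinite_finite_induct) (auto simp: reducible_0 reducible_add)

lemma bounding_reducible: "x \<in> bounding \<Longrightarrow> x \<in> reducible"
  by (auto simp: reducible_def normal_form_def intro!: exI[of _ "\<lambda>_. 0"])

lemma finite_generators: "finite (sphere_edges \<union> punctured_squares)"
  by (simp add: sphere_edges_def punctured_squares_def)

lemma normal_generator_reducible:
  assumes "p \<in> sphere_edges \<union> punctured_squares"
  shows "normal_generator p \<in> reducible" (is "?g \<in> _")
proof -
  have "normal_form (\<lambda>q. if q = p then 1 else 0) = ?g"
    unfolding normal_form_def
    by (subst sum.mono_neutral_right[OF finite_generators, of "{p}"]) (use assms in auto)
  then show ?thesis
    unfolding reducible_def mem_Collect_eq
    by (intro exI[of _ "\<lambda>q. if q = p then 1 else 0"]) (simp add: bounding_0)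
qed

lemma reducible_spike:
  assumes "v \<in> nbrs u"
  shows "Poly_Mapping.single [u, v, u] 1 \<in> reducible"
proof -
  have "[u, v] \<in> sphere_edges \<or> [v, u] \<in> sphere_edges"
    using vertex_cases[OF conjunct1[OF nbrs_verts[OF assms]]] assms
    by (elim disjE) (auto simp: nbrs_eq sphere_edges_def)
  then show ?thesis
  proof
    assume "[u, v] \<in> sphere_edges"
    then show ?thesis
      using normal_generator_reducible[of "[u, v]"] by simp
  next
    assume "[v, u] \<in> sphere_edges"
    then have "Poly_Mapping.single [v, u, v] 1 \<in> reducible"
      using normal_generator_reducible[of "[v, u]"] by simp
    then show ?thesis
      using reducible_diff[OF _ bounding_reducible[OF bounding_swap[OF assms]], of "Poly_Mapping.single [v, u, v] 1"]
      by simp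
  qed
qed

text \<open>The type token fixes the coefficient ring, so that membership becomes a relation on four
  vertices to which the symmetries of a square apply.\<close>

definition square_reducible ::
  "'r::comm_ring_1 itself \<Rightarrow> nat \<Rightarrow> nat \<Rightarrow> nat \<Rightarrow> nat \<Rightarrow> bool" where
  "square_reducible _ a b c d \<longleftrightarrow> path_square a b c d \<in> (reducible :: (nat list \<Rightarrow>\<^sub>0 'r) set)"

lemma square_reducible_rotate:
  fixes R :: "'r::comm_ring_1 itself"
  assumes "square_reducible R b c d a" "b \<in> nbrs a" "c \<in> nbrs b" "d \<in> nbrs c" "a \<in> nbrs d"
  shows "square_reducible R a b c d"
proof -
  let ?s = "path_square :: nat \<Rightarrow> nat \<Rightarrow> nat \<Rightarrow> nat \<Rightarrow> nat list \<Rightarrow>\<^sub>0 'r"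
  have "(?s a b c d - ?s b c d a - Poly_Mapping.single [a, b, a] 1
      + Poly_Mapping.single [d, c, d] 1) + (?s b c d a + Poly_Mapping.single [a, b, a] 1
      - Poly_Mapping.single [d, c, d] 1) \<in> reducible"
  proof (rule reducible_add)
    show "?s a b c d - ?s b c d a - Poly_Mapping.single [a, b, a] 1
      + Poly_Mapping.single [d, c, d] 1 \<in> reducible"
      using assms(2-5) by (rule bounding_reducible[OF bounding_rotate])
    have "c \<in> nbrs d"
      using assms(4) nbrs_sym by blast
    then show "?s b c d a + Poly_Mapping.single [a, b, a] 1 - Poly_Mapping.single [d, c, d] 1 \<in> reducible"
      using assms(1,2) by (auto simp: square_reducible_def intro!: reducible_add reducible_diff reducible_spike)
  qed
  then show ?thesis
    by (simp add: square_reducible_def)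
qed

lemma square_reducible_flip:
  fixes R :: "'r::comm_ring_1 itself"
  shows "square_reducible R a d c b \<longleftrightarrow> square_reducible R a b c d"
proof -
  have "path_square a d c b = - (path_square a b c d :: nat list \<Rightarrow>\<^sub>0 'r)"
    by (simp add: path_square_def)
  then show ?thesis
    by (simp add: square_reducible_def reducible_uminus)
qed

lemma square_reducible_dihedral:
  assumes "square_reducible R a b c d" "b \<in> nbrs a" "c \<in> nbrs b" "d \<in> nbrs c" "a \<in> nbrs d"
  shows "square_reducible R b c d a" "square_reducible R c d a b"
    "square_reducible R d a b c" "square_reducible R a d c b"
    "square_reducible R b a d c" "square_reducible R c b a d"
    "square_reducible R d c b a"
proof -
  \<comment> \<open>\<open>square_reducible_rotate\<close> moves the last vertex to the front, which
    dictates the order of the three rotations.\<close>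
  show d: "square_reducible R d a b c"
    by (rule square_reducible_rotate) (use assms in simp_all)
  show c: "square_reducible R c d a b"
    by (rule square_reducible_rotate) (use assms d in simp_all)
  show b: "square_reducible R b c d a"
    by (rule square_reducible_rotate) (use assms c in simp_all)
  show "square_reducible R a d c b" "square_reducible R b a d c"
    "square_reducible R c b a d" "square_reducible R d c b a"
    using assms(1) b c d square_reducible_flip by blast+
qed

lemma square_reducible_sphere:
  fixes R :: "'r::comm_ring_1 itself"
  shows "square_reducible R 1 2 6 3" "square_reducible R 1 3 8 5" "square_reducible R 1 5 9 4"
    "square_reducible R 1 4 7 2" "square_reducible R 2 7 10 6" "square_reducible R 3 6 10 8"
    "square_reducible R 5 8 10 9" "square_reducible R 4 9 10 7"
proof -
  let ?s = "path_square :: nat \<Rightarrow> nat \<Rightarrow> nat \<Rightarrow> nat \<Rightarrow> nat list \<Rightarrow>\<^sub>0 'r"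
  have "square_reducible R a b c d" if "[a, b, c, d] \<in> punctured_squares" for a b c d
    using normal_generator_reducible[of "[a, b, c, d]"] that by (simp add: square_reducible_def)
  then show s: "square_reducible R 1 3 8 5" "square_reducible R 1 5 9 4" "square_reducible R 1 4 7 2"
    "square_reducible R 2 7 10 6" "square_reducible R 3 6 10 8" "square_reducible R 5 8 10 9"
    "square_reducible R 4 9 10 7"
    by (simp_all add: punctured_squares_def)
  \<comment> \<open>Subtracting the seven generators from the bounding sum isolates the square that
    \<open>punctured_squares\<close> omits.\<close>
  have "?s 1 2 6 3 + ?s 1 3 8 5 + ?s 1 5 9 4 + ?s 1 4 7 2 +
      ?s 2 7 10 6 + ?s 3 6 10 8 + ?s 5 8 10 9 + ?s 4 9 10 7
    - ?s 4 9 10 7 - ?s 5 8 10 9 - ?s 3 6 10 8 - ?s 2 7 10 6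
    - ?s 1 4 7 2 - ?s 1 5 9 4 - ?s 1 3 8 5 \<in> reducible"
    by (intro reducible_diff bounding_reducible[OF bounding_sphere]
        s[unfolded square_reducible_def])
  then show "square_reducible R 1 2 6 3"
    by (simp add: square_reducible_def)
qed

text \<open>The graph has exactly eight 4-cycles, the faces of the sphere. The eight squares and
  their dihedral images therefore exhaust the cases.\<close>

lemma square_reducible_all:
  assumes "b \<in> nbrs a" "c \<in> nbrs b" "d \<in> nbrs c" "a \<in> nbrs d" "a \<noteq> c" "b \<noteq> d"
  shows "square_reducible R a b c d"
proof -
  have "d \<in> nbrs a"
    using assms(4) nbrs_sym[of a d] by simp
  moreover note * = square_reducible_sphere square_reducible_sphere[THEN square_reducible_dihedral(1)]
    square_reducible_sphere[THEN square_reducible_dihedral(2)]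
    square_reducible_sphere[THEN square_reducible_dihedral(3)]
    square_reducible_sphere[THEN square_reducible_dihedral(4)]
    square_reducible_sphere[THEN square_reducible_dihedral(5)]
    square_reducible_sphere[THEN square_reducible_dihedral(6)]
    square_reducible_sphere[THEN square_reducible_dihedral(7)]
  ultimately show ?thesis
    using vertex_cases[OF conjunct1[OF nbrs_verts[OF assms(1)]]] assms
    by (elim disjE) (auto simp: nbrs_eq * simp del: One_nat_def)
qed

text \<open>This is what restricts cycles to spikes and squares: distinct end points of a path of
  length two are not adjacent, and at most two middle vertices join them.\<close>

lemma common_nbrs:
  assumes "u \<in> V" "w \<in> V" "u \<noteq> w"
  shows "nbrs u \<inter> nbrs w = {} \<or>
    w \<notin> nbrs u \<and> (card (nbrs u \<inter> nbrs w) = 1 \<or> card (nbrs u \<inter> nbrs w) = 2)"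
  using vertex_cases[OF assms(1)] vertex_cases[OF assms(2)] assms(3)
  by (elim disjE) (simp_all add: nbrs_eq)

lemma lookup_boundary_2:
  assumes "x \<in> supported (allowed_paths example_graph 2)"
  shows "Poly_Mapping.lookup (linear_extension (tuple_boundary 2) x) [u, w] =
    (\<Sum>v\<in>V. Poly_Mapping.lookup x [v, u, w]) - (\<Sum>v\<in>V. Poly_Mapping.lookup x [u, v, w])
    + (\<Sum>v\<in>V. Poly_Mapping.lookup x [u, w, v])"
proof -
  \<comment> \<open>Since \<open>u\<close> and \<open>w\<close> are arbitrary, both sides also have
    to agree when one of them is not a vertex.\<close>
  have outside: "Poly_Mapping.lookup x [a, b, c] = 0" if "a \<notin> V \<or> b \<notin> V \<or> c \<notin> V" for a b c
    using assms that nbrs_verts[of b a] nbrs_verts[of c b] allowed_paths_2[of a b c]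
    unfolding supported_iff by blast
  define A where "A = (\<lambda>(a, b, c). [a, b, c]) ` (V \<times> V \<times> V)"
  have fin: "finite V"
    by (simp add: verts_example)
  have "p \<in> A" if "p \<in> Poly_Mapping.keys x" for p
  proof -
    have "p \<in> allowed_paths example_graph 2"
      using assms that by (auto simp: supported_def)
    then show ?thesis
      by (auto simp: A_def allowed_paths_def vertex_tuples_def length_3_iff image_iff)
  qed
  then have "Poly_Mapping.lookup (linear_extension (tuple_boundary 2) x) [u, w] =
    (\<Sum>p\<in>A. Poly_Mapping.lookup x p * Poly_Mapping.lookup (tuple_boundary 2 p) [u, w])"
    using fin by (intro lookup_linear_extension) (auto simp: A_def)
  also have "\<dots> = (\<Sum>(a, b, c)\<in>V \<times> V \<times> V. Poly_Mapping.lookup x [a, b, c] *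
      Poly_Mapping.lookup (tuple_boundary 2 [a, b, c]) [u, w])"
    unfolding A_def by (subst sum.reindex) (auto simp: inj_on_def case_prod_unfold)
  also have "\<dots> = (\<Sum>a\<in>V. \<Sum>b\<in>V. \<Sum>c\<in>V.
      (if b = u \<and> c = w then Poly_Mapping.lookup x [a, b, c] else 0)
      - (if a = u \<and> c = w then Poly_Mapping.lookup x [a, b, c] else 0)
      + (if a = u \<and> b = w then Poly_Mapping.lookup x [a, b, c] else 0))"
    unfolding sum.cartesian_product[symmetric]
    by (intro sum.cong refl)
      (auto simp: tuple_boundary_2 lookup_add lookup_minus lookup_single when_def algebra_simps)
  also have "\<dots> = (\<Sum>v\<in>V. Poly_Mapping.lookup x [v, u, w]) - (\<Sum>v\<in>V. Poly_Mapping.lookup x [u, v, w])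
    + (\<Sum>v\<in>V. Poly_Mapping.lookup x [u, w, v])"
  proof -
    have if_conj: "(if P \<and> Q then t else 0) = (if P then if Q then t else 0 else 0)" for P Q and t :: 'a
      by simp
    have pull: "(\<Sum>i\<in>I. if P then f i else 0) = (if P then sum f I else 0)"
      for P and f :: "nat \<Rightarrow> 'a" and I
      by simp
    show ?thesis
      unfolding sum.distrib sum_subtractf if_conj pull sum.delta[OF fin] using outside
      by (auto intro!: sum.cong)
  qed
  finally show ?thesis .
qed

text \<open>The middle vertex is summed innermost, which groups the paths by their end
  points.\<close>

lemma eq_sum_single:
  assumes "x \<in> supported (allowed_paths example_graph 2)"
  shows "x = (\<Sum>u\<in>V. \<Sum>w\<in>V. \<Sum>v\<in>V. Poly_Mapping.single [u, v, w] (Poly_Mapping.lookup x [u, v, w]))"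
    (is "_ = ?y")
proof (rule poly_mapping_eqI)
  fix p
  have fin: "finite V"
    by (simp add: verts_example)
  show "Poly_Mapping.lookup x p = Poly_Mapping.lookup ?y p"
  proof (cases "p \<in> allowed_paths example_graph 2")
    case True
    then obtain a b c where p: "p = [a, b, c]" and V: "a \<in> V" "b \<in> V" "c \<in> V"
      by (auto simp: allowed_paths_def vertex_tuples_def length_3_iff)
    have if_conj: "(if u = a \<and> v = b \<and> w = c then t else 0) =
      (if u = a then if w = c then if v = b then t else 0 else 0 else 0)" for u v w and t :: 'a
      by simp
    have pull: "(\<Sum>i\<in>I. if P then f i else 0) = (if P then sum f I else 0)"
      for P and f :: "nat \<Rightarrow> 'a" and I
      by simp
    show ?thesis
      using V by (simp add: p lookup_sum lookup_single when_def if_conj pull sum.delta[OF fin])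
  next
    case False
    then have "Poly_Mapping.lookup x p = 0"
      using assms by (simp add: supported_iff)
    then show ?thesis
      by (auto simp: lookup_sum lookup_single when_def intro!: sum.neutral)
  qed
qed

text \<open>For fixed end points, equal ends give spikes. Distinct ends with one common neighbour
  contribute nothing, and with two they contribute a multiple of a
  \<open>path_square\<close>.\<close>

lemma cycle_reducible:
  fixes x :: "nat list \<Rightarrow>\<^sub>0 'r::comm_ring_1"
  assumes x: "x \<in> supported (allowed_paths example_graph 2)"
    and cycle: "linear_extension (tuple_boundary 2) x \<in> supported (degenerate_tuples V 1)"
  shows "x \<in> reducible"
proof -
  let ?c = "\<lambda>u v w. Poly_Mapping.lookup x [u, v, w]"
  have not_allowed: "?c u v w = 0" if "v \<notin> nbrs u \<or> w \<notin> nbrs v" for u v w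
    using x that by (auto simp: supported_iff allowed_paths_2)
  have spike: "Poly_Mapping.single [u, v, u] r \<in> reducible" if "v \<in> nbrs u" for u v and r :: 'r
    using reducible_scale[OF reducible_spike[OF that], of r] by simp
  have T: "(\<Sum>v\<in>V. Poly_Mapping.single [u, v, w] (?c u v w)) \<in> reducible"
    if V: "u \<in> V" "w \<in> V" for u w
  proof (cases "u = w")
    case True
    have "Poly_Mapping.single [u, v, u] (?c u v u) \<in> reducible" for v
      using spike[of v u] not_allowed[of v u u] by (cases "v \<in> nbrs u") (simp_all add: reducible_0)
    then show ?thesis
      unfolding True[symmetric] by (intro reducible_sum)
  next
    case False
    have C: "nbrs u \<inter> nbrs w \<subseteq> V"
      using nbrs_verts by blast
    have zero: "?c u v w = 0" if "v \<notin> nbrs u \<inter> nbrs w" for v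
      using that not_allowed[of v u w] nbrs_sym[of w v] by auto
    have fin: "finite V"
      by (simp add: verts_example)
    have eq: "(\<Sum>v\<in>V. Poly_Mapping.single [u, v, w] (?c u v w)) =
      (\<Sum>v\<in>nbrs u \<inter> nbrs w. Poly_Mapping.single [u, v, w] (?c u v w))"
      using fin C zero by (intro sum.mono_neutral_right) auto
    consider "nbrs u \<inter> nbrs w = {}"
      | "w \<notin> nbrs u" "card (nbrs u \<inter> nbrs w) = 1 \<or> card (nbrs u \<inter> nbrs w) = 2"
      using common_nbrs[OF V False] by blast
    then show ?thesis
    proof cases
      case 1
      then show ?thesis
        unfolding eq by (simp add: reducible_0)
    next
      case 2
      \<comment> \<open>As \<open>u\<close> and \<open>w\<close> are not adjacent, no allowed path
        has them as consecutive vertices, so only the middle sum of \<open>lookup_boundary_2\<close>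
        survives. It vanishes because \<open>[u, w]\<close> is not degenerate.\<close>
      have "(\<Sum>v\<in>V. ?c u v w) = 0"
        using cycle lookup_boundary_2[OF x, of u w] 2(1) False not_allowed[of _ u w] nbrs_sym[of u w]
        by (simp add: supported_iff degenerate_tuples_1 not_allowed del: One_nat_def)
      then have sum: "(\<Sum>v\<in>nbrs u \<inter> nbrs w. ?c u v w) = 0"
        using fin C zero by (subst sum.mono_neutral_left[of V]) auto
      from 2(2) show ?thesis
      proof
        assume "card (nbrs u \<inter> nbrs w) = 1"
        then obtain v where "nbrs u \<inter> nbrs w = {v}"
          by (rule card_1_singletonE)
        then show ?thesis
          using sum unfolding eq by (simp add: reducible_0)
      next
        assume "card (nbrs u \<inter> nbrs w) = 2"
        then obtain v v' where v: "nbrs u \<inter> nbrs w = {v, v'}" "v \<noteq> v'"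
          by (auto simp: card_2_iff)
        then have "?c u v' w = - ?c u v w"
          using sum by (simp add: eq_neg_iff_add_eq_0 add.commute)
        then have "(\<Sum>v\<in>V. Poly_Mapping.single [u, v, w] (?c u v w)) =
            pm_scale (?c u v w) (path_square u v w v')"
          using v unfolding eq by (simp add: path_square_def pm_scale_diff single_uminus)
        moreover have "v \<in> nbrs u" "v \<in> nbrs w" "v' \<in> nbrs u" "v' \<in> nbrs w"
          using v by blast+
        then have "square_reducible TYPE('r) u v w v'"
          using v False nbrs_sym[of v w] nbrs_sym[of u v'] by (intro square_reducible_all) simp_all
        ultimately show ?thesis
          by (simp add: reducible_scale square_reducible_def)
      qed
    qed
  qed
  have "(\<Sum>u\<in>V. \<Sum>w\<in>V. \<Sum>v\<in>V. Poly_Mapping.single [u, v, w] (?c u v w)) \<in> reducible"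
    by (intro reducible_sum T)
  then show ?thesis
    using eq_sum_single[OF x] by simp
qed

lemma bounding_cycle:
  assumes "x \<in> bounding"
  shows "linear_extension (tuple_boundary 2) x \<in> supported (degenerate_tuples V 1)"
proof -
  obtain y z where y: "y \<in> supported (allowed_paths example_graph 3)"
    and xyz: "x = linear_extension (tuple_boundary 3) y + z" "z \<in> supported (degenerate_tuples V 2)"
    using assms by (elim boundingE)
  have "length p = 4" if "p \<in> Poly_Mapping.keys y" for p
    using y that by (auto simp: supported_def allowed_paths_def vertex_tuples_def)
  then have "linear_extension (tuple_boundary 2) (linear_extension (tuple_boundary 3) y) = 0"
    unfolding linear_extension_linear_extension
    by (simp add: linear_extension_def[of "\<lambda>b. linear_extension (tuple_boundary 2) (tuple_boundary 3 b)"]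
        tuple_boundary_boundary)
  then show ?thesis
    using linear_extension_supported[OF xyz(2) tuple_boundary_2_degenerate]
    by (simp add: xyz(1) linear_extension_add)
qed

lemma normal_form_cycle:
  assumes "linear_extension (tuple_boundary 2) (normal_form f) \<in> supported (degenerate_tuples V 1)"
  shows "normal_form f = 0"
proof -
  have coeff: "Poly_Mapping.lookup (linear_extension (tuple_boundary 2) (normal_form f)) [u, w] = 0"
    if "u \<noteq> w" for u w
    using assms that by (auto simp: supported_iff degenerate_tuples_1 simp del: One_nat_def)
  let ?g = "\<lambda>p q. Poly_Mapping.lookup (linear_extension (tuple_boundary 2) (normal_generator p)) q"
  have disj: "sphere_edges \<inter> punctured_squares = {}"
    by (simp add: sphere_edges_def punctured_squares_def)
  have total: "(\<Sum>p\<in>sphere_edges. f p * ?g p [u, w]) + (\<Sum>p\<in>punctured_squares. f p * ?g p [u, w]) = 0"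
    if "u \<noteq> w" for u w
    using coeff[OF that] finite_generators
    by (simp add: normal_form_def linear_extension_sum linear_extension_scale lookup_sum
        sum.union_disjoint[OF _ _ disj])
  have edge: "?g [a, b] [u, w] = (if [u, w] = [a, b] \<or> [u, w] = [b, a] then 1 else 0)"
    if "u \<noteq> w" for a b u w
    using that by (auto simp: tuple_boundary_2 lookup_add lookup_minus lookup_single when_def)
  have square: "?g [a, b, c, d] [u, w] = (if [a, b] = [u, w] then 1 else 0) + (if [b, c] = [u, w] then 1 else 0)
      - (if [a, d] = [u, w] then 1 else 0) - (if [d, c] = [u, w] then 1 else 0)" for a b c d u w
    by (simp add: path_square_def linear_extension_diff tuple_boundary_2 lookup_add lookup_minus
        lookup_single when_def split del: if_split)
  have ascending: "\<exists>a b. p = [a, b] \<and> a < b" if "p \<in> sphere_edges" for p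
    using that unfolding sphere_edges_def by auto
  \<comment> \<open>The descending pair \<open>[b, a]\<close> occurs only in the boundary of the
    spike with key \<open>[a, b]\<close>, since squares contribute ascending pairs.\<close>
  have edge_coeff: "f [a, b] = 0" if "[a, b] \<in> sphere_edges" for a b
  proof -
    have ab: "a < b"
      using ascending[OF that] by simp
    have "f p * ?g p [b, a] = (if p = [a, b] then f p else 0)" if "p \<in> sphere_edges" for p
      using ascending[OF that] ab by (auto simp: edge simp del: normal_generator.simps split: if_splits)
    then have "(\<Sum>p\<in>sphere_edges. f p * ?g p [b, a]) = (\<Sum>p\<in>sphere_edges. if p = [a, b] then f p else 0)"
      by (intro sum.cong refl)
    also have "\<dots> = f [a, b]"
      using that finite_generators by (simp add: sum.delta)
    finally have "(\<Sum>p\<in>sphere_edges. f p * ?g p [b, a]) = f [a, b]" .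
    moreover have "f p * ?g p [b, a] = 0" if "p \<in> punctured_squares" for p
      using that ab unfolding punctured_squares_def
      by (auto simp: square simp del: normal_generator.simps)
    ultimately show ?thesis
      using total[of b a] ab by simp
  qed
  then have edges: "f p = 0" if "p \<in> sphere_edges" for p
    using that ascending[OF that] by auto
  have total': "(\<Sum>p\<in>punctured_squares. f p * ?g p [u, w]) = 0" if "u \<noteq> w" for u w
    using total[OF that] by (simp add: edges)
  \<comment> \<open>Each side of the omitted square 1, 2, 6, 3 borders just one of the remaining
    squares.\<close>
  have "f [1, 4, 7, 2] = 0" "f [2, 7, 10, 6] = 0" "f [1, 3, 8, 5] = 0" "f [3, 6, 10, 8] = 0"
    using total'[of 1 2] total'[of 2 6] total'[of 1 3] total'[of 3 6]
    by (simp_all add: punctured_squares_def square del: One_nat_def normal_generator.simps)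
  \<comment> \<open>Each of the edges \<open>[1, 5]\<close>, \<open>[4, 7]\<close> and
    \<open>[8, 10]\<close> separates a square that is already settled from a new one.\<close>
  moreover from this have "f [1, 5, 9, 4] = 0" "f [4, 9, 10, 7] = 0" "f [5, 8, 10, 9] = 0"
    using total'[of 1 5] total'[of 4 7] total'[of 8 10]
    by (simp_all add: punctured_squares_def square del: One_nat_def normal_generator.simps)
  ultimately have squares: "f p = 0" if "p \<in> punctured_squares" for p
    using that by (auto simp: punctured_squares_def simp del: One_nat_def)
  show ?thesis
    unfolding normal_form_def using edges squares by (intro sum.neutral) auto
qed

text \<open>The normal form of a cycle differs from it by an element of \<open>bounding\<close>, so
  it is itself a cycle and vanishes by \<open>normal_form_cycle\<close>.\<close>

lemma cycle_bounding:
  fixes x :: "nat list \<Rightarrow>\<^sub>0 'r::comm_ring_1"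
  assumes "x \<in> supported (allowed_paths example_graph 2)"
    and cycle: "linear_extension (tuple_boundary 2) x \<in> supported (degenerate_tuples V 1)"
  shows "x \<in> bounding"
proof -
  obtain f where f: "x - normal_form f \<in> bounding"
    using cycle_reducible[OF assms] by (auto simp: reducible_def)
  have "linear_extension (tuple_boundary 2) (normal_form f) =
      linear_extension (tuple_boundary 2) x - linear_extension (tuple_boundary 2) (x - normal_form f)"
    by (simp add: linear_extension_diff)
  then have "linear_extension (tuple_boundary 2) (normal_form f) \<in> supported (degenerate_tuples V 1)"
    using cycle bounding_cycle[OF f] by (simp add: supported_diff)
  then show ?thesis
    using f normal_form_cycle by force
qed

section \<open>Passage from representatives to path homology classes\<close>

lemma allowed_chains_eq:
  "allowed_chains example_graph n = coset (supported (degenerate_tuples V n)) ` supported (allowed_paths example_graph n)"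
  by (simp add: allowed_chains_def degenerate_tuple_chains_def carrier_free_module r_coset_free_module)

lemma tuple_chain_boundary_2:
  "tuple_chain_boundary U 2 (coset (supported (degenerate_tuples U 2)) x) =
    coset (supported (degenerate_tuples U 1)) (linear_extension (tuple_boundary 2) x)"
  using quotient_map_coset[OF tuple_boundary_2_degenerate]
  by (simp add: tuple_chain_boundary_def degenerate_tuple_chains_def carrier_free_module)

lemma tuple_chain_boundary_3:
  "tuple_chain_boundary U 3 (coset (supported (degenerate_tuples U 3)) x) =
    coset (supported (degenerate_tuples U 2)) (linear_extension (tuple_boundary 3) x)"
  using quotient_map_coset[OF tuple_boundary_3_degenerate]
  by (simp add: tuple_chain_boundary_def degenerate_tuple_chains_def carrier_free_module)

lemma path_chains_carrier:
  "carrier (path_chains example_graph n) = {x \<in> allowed_chains example_graph n.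
     n = 0 \<or> tuple_chain_boundary V n x \<in> allowed_chains example_graph (n - 1)}"
  by (simp add: path_chains_def)

lemma zero_carrier_update: "\<zero>\<^bsub>M\<lparr>carrier := S\<rparr>\<^esub> = \<zero>\<^bsub>M\<^esub>"
  by simp

lemma zero_quotient_module: "\<zero>\<^bsub>quotient_module M N\<^esub> = N"
  by (simp add: quotient_module_def)

lemma path_cycles:
  fixes X :: "(nat list \<Rightarrow>\<^sub>0 'r::comm_ring_1) set"
  shows "X \<in> cycles (path_chains example_graph) (tuple_chain_boundary V) 2 \<longleftrightarrow>
    (\<exists>x\<in>supported (allowed_paths example_graph 2). X = coset (supported (degenerate_tuples V 2)) x \<and>
      linear_extension (tuple_boundary 2) x \<in> supported (degenerate_tuples V 1))"
proof -
  let ?D1 = "supported (degenerate_tuples V 1) :: (nat list \<Rightarrow>\<^sub>0 'r) set"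
  have "2 - 1 = (1 :: nat)"
    by simp
  have zero: "\<zero>\<^bsub>path_chains example_graph 1\<^esub> = ?D1"
    by (simp only: path_chains_def tuple_chains_def zero_carrier_update zero_quotient_module
        degenerate_tuple_chains_def carrier_free_module)
  \<comment> \<open>The zero class is allowed, so a vanishing boundary already entails the boundary
    condition in \<open>path_chains\<close>.\<close>
  have mem: "?D1 \<in> allowed_chains example_graph 1"
    unfolding allowed_chains_eq by (rule image_eqI[of _ _ 0]) (simp_all add: coset_0)
  have coset: "coset ?D1 y = ?D1 \<longleftrightarrow> y \<in> ?D1" for y
    using coset_eq_iff[of "degenerate_tuples V 1" y 0] by (simp add: coset_0)
  have "X \<in> cycles (path_chains example_graph) (tuple_chain_boundary V) 2 \<longleftrightarrow>
      X \<in> allowed_chains example_graph 2 \<and> tuple_chain_boundary V 2 X = ?D1"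
    unfolding cycles_def path_chains_carrier \<open>2 - 1 = 1\<close> zero mem_Collect_eq using mem by metis
  also have "\<dots> \<longleftrightarrow> (\<exists>x\<in>supported (allowed_paths example_graph 2).
      X = coset (supported (degenerate_tuples V 2)) x \<and> tuple_chain_boundary V 2 X = ?D1)"
    unfolding allowed_chains_eq image_iff by blast
  also have "\<dots> \<longleftrightarrow> (\<exists>x\<in>supported (allowed_paths example_graph 2).
      X = coset (supported (degenerate_tuples V 2)) x \<and> linear_extension (tuple_boundary 2) x \<in> ?D1)"
    by (intro bex_cong refl conj_cong) (simp only: tuple_chain_boundary_2 coset)
  finally show ?thesis .
qed

text \<open>The second representative \<open>x\<close> expresses that the boundary of
  \<open>y\<close> is an allowed class, which is what makes \<open>y\<close> a path chain.\<close>

lemma path_boundaries: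
  fixes X :: "(nat list \<Rightarrow>\<^sub>0 'r::comm_ring_1) set"
  shows "X \<in> boundaries (path_chains example_graph) (tuple_chain_boundary V) 2 \<longleftrightarrow>
    (\<exists>y\<in>supported (allowed_paths example_graph 3). \<exists>x\<in>supported (allowed_paths example_graph 2).
      X = coset (supported (degenerate_tuples V 2)) (linear_extension (tuple_boundary 3) y) \<and>
      X = coset (supported (degenerate_tuples V 2)) x)"
proof -
  let ?C = "path_chains example_graph :: nat \<Rightarrow> ('r, (nat list \<Rightarrow>\<^sub>0 'r) set) module"
  have "carrier (?C 3) = coset (supported (degenerate_tuples V 3)) `
      {y \<in> supported (allowed_paths example_graph 3).
        coset (supported (degenerate_tuples V 2)) (linear_extension (tuple_boundary 3) y)
          \<in> allowed_chains example_graph 2}"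
    unfolding path_chains_carrier allowed_chains_eq[of 3] by (auto simp: tuple_chain_boundary_3)
  moreover have "Suc 2 = 3"
    by simp
  ultimately have "boundaries ?C (tuple_chain_boundary V) 2 =
      (\<lambda>y. coset (supported (degenerate_tuples V 2)) (linear_extension (tuple_boundary 3) y)) `
      {y \<in> supported (allowed_paths example_graph 3).
        coset (supported (degenerate_tuples V 2)) (linear_extension (tuple_boundary 3) y)
          \<in> coset (supported (degenerate_tuples V 2)) ` supported (allowed_paths example_graph 2)}"
    by (simp add: boundaries_def image_image tuple_chain_boundary_3 allowed_chains_eq)
  then show ?thesis
    by (simp only:) blast
qed

lemma path_homology_2_zero:
  "path_homology TYPE('r::comm_ring_1) example_graph 2 \<cong>\<^sub>M (zero_module :: ('r, unit) module)"
proof -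
  let ?C = "path_chains example_graph :: nat \<Rightarrow> ('r, (nat list \<Rightarrow>\<^sub>0 'r) set) module"
  let ?Z = "cycles ?C (tuple_chain_boundary V) 2"
  let ?B = "boundaries ?C (tuple_chain_boundary V) 2"
  let ?coset = "coset (supported (degenerate_tuples V 2)) :: _ \<Rightarrow> (nat list \<Rightarrow>\<^sub>0 'r) set"
  let ?d = "linear_extension (tuple_boundary 3) :: (nat list \<Rightarrow>\<^sub>0 'r) \<Rightarrow> _"
  have add: "?coset x \<oplus>\<^bsub>?C 2\<^esub> ?coset y = ?coset (x + y)" for x y
    using quotient_module_add[where B = "degenerate_tuples V 2" and x = x and y = y]
    by (simp add: path_chains_def tuple_chains_def)
  let ?A = "\<lambda>n. supported (allowed_paths example_graph n) :: (nat list \<Rightarrow>\<^sub>0 'r) set"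
  let ?D = "supported (degenerate_tuples V 2) :: (nat list \<Rightarrow>\<^sub>0 'r) set"
  have B_iff: "b \<in> ?B \<longleftrightarrow> (\<exists>v\<in>?A 3. \<exists>w\<in>?A 2. b = ?coset (?d v) \<and> ?d v - w \<in> ?D)" for b
    unfolding path_boundaries coset_eq_iff[symmetric] by (intro bex_cong refl conj_cong) (simp only:)
  have memB: "?coset (?d v) \<in> ?B" if "v \<in> ?A 3" "w \<in> ?A 2" "?d v - w \<in> ?D" for v w
    unfolding B_iff by (intro bexI[OF _ that(1)] bexI[OF _ that(2)] conjI refl that(3))
  \<comment> \<open>A homology class is the translate of \<open>?B\<close> by a cycle. As every
    cycle bounds, each translate is \<open>?B\<close> itself.\<close>
  have absorb: "(\<lambda>b. b \<oplus>\<^bsub>?C 2\<^esub> X) ` ?B = ?B" if cycle: "X \<in> ?Z" for X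
  proof -
    obtain x where x: "x \<in> ?A 2" "X = ?coset x"
        "linear_extension (tuple_boundary 2) x \<in> supported (degenerate_tuples V 1)"
      using cycle unfolding path_cycles by blast
    obtain y z where y: "y \<in> ?A 3" "x = ?d y + z" "z \<in> ?D"
      using boundingE[OF cycle_bounding[OF x(1,3)]] .
    have yx: "?d y - x \<in> ?D"
      using y(2,3) by simp
    have X: "X = ?coset (?d y)"
      using x(2) y(2,3) by (simp add: coset_eq_iff)
    have shift: "?coset (?d v) \<oplus>\<^bsub>?C 2\<^esub> X = ?coset (?d (v + y))" for v
      by (simp add: X add linear_extension_add)
    show ?thesis
    proof (intro equalityI subsetI)
      fix b assume "b \<in> (\<lambda>b. b \<oplus>\<^bsub>?C 2\<^esub> X) ` ?B"
      then obtain b' where b': "b = b' \<oplus>\<^bsub>?C 2\<^esub> X" "b' \<in> ?B"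
        by (rule imageE)
      from b'(2) obtain v w where v: "v \<in> ?A 3" "w \<in> ?A 2" "b' = ?coset (?d v)" "?d v - w \<in> ?D"
        unfolding B_iff by (elim bexE conjE)
      have "?d (v + y) - (w + x) = (?d v - w) + (?d y - x)"
        by (simp add: linear_extension_add)
      then have "?d (v + y) - (w + x) \<in> ?D"
        using supported_add[OF v(4) yx] by (simp only:)
      then show "b \<in> ?B"
        unfolding b'(1) v(3) shift by (rule memB[OF supported_add[OF v(1) y(1)] supported_add[OF v(2) x(1)]])
    next
      fix b assume "b \<in> ?B"
      then obtain v w where v: "v \<in> ?A 3" "w \<in> ?A 2" "b = ?coset (?d v)" "?d v - w \<in> ?D"
        unfolding B_iff by (elim bexE conjE)
      have "?d (v - y) - (w - x) = (?d v - w) - (?d y - x)"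
        by (simp add: linear_extension_diff)
      then have "?d (v - y) - (w - x) \<in> ?D"
        using supported_diff[OF v(4) yx] by (simp only:)
      then have "?coset (?d (v - y)) \<in> ?B"
        by (rule memB[OF supported_diff[OF v(1) y(1)] supported_diff[OF v(2) x(1)]])
      moreover have "b = ?coset (?d (v - y)) \<oplus>\<^bsub>?C 2\<^esub> X"
        by (simp add: shift v(3))
      ultimately show "b \<in> (\<lambda>b. b \<oplus>\<^bsub>?C 2\<^esub> X) ` ?B"
        by (rule rev_image_eqI)
    qed
  qed
  have "?coset 0 \<in> ?Z"
    unfolding path_cycles by (intro bexI[of _ 0]) simp_all
  then have "carrier (path_homology TYPE('r) example_graph 2) = {?B}"
    unfolding path_homology_def carrier_homology using absorb by auto
  then show ?thesis
    by (rule singleton_carrier_isomorphic_zero)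
qed

section \<open>Discrete cubical homology\<close>

text \<open>The arguments are the corners of a closed walk in cyclic order. The positive cases are
  the four rotations of 1, 2, 6, 3, the negative ones those of the reversed walk.\<close>

definition square_degree :: "nat \<Rightarrow> nat \<Rightarrow> nat \<Rightarrow> nat \<Rightarrow> int" where
  "square_degree a b c d =
    (if (a, b, c, d) \<in> {(1, 2, 6, 3), (2, 6, 3, 1), (6, 3, 1, 2), (3, 1, 2, 6)} then 1
     else if (a, b, c, d) \<in> {(1, 3, 6, 2), (3, 6, 2, 1), (6, 2, 1, 3), (2, 1, 3, 6)} then - 1 else 0)"

text \<open>
  The values of \<open>half_area\<close> come from a spanning tree of the dual graph, along which each of the seven
  other squares passes its unit of area to the square 1, 2, 6, 3.
\<close>

definition half_area :: "nat \<Rightarrow> nat \<Rightarrow> int" where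
  "half_area u v = (if (u, v) = (1, 2) then 3 else if (u, v) = (6, 3) then 2
     else if (u, v) \<in> {(2, 6), (3, 1), (1, 4), (4, 7), (10, 8)} then 1 else 0)"

text \<open>The circulation is 7 around 1, 2, 6, 3 and -1 around each other face in the orientation
  of the sphere, so \<open>8 * square_degree\<close> minus it is 1 on every face. The 7 splits as 3
  + 1 + 2 + 1 over the sides of 1, 2, 6, 3, according to how many squares of the spanning tree hang
  on each side.\<close>

definition area :: "nat \<Rightarrow> nat \<Rightarrow> int" where
  "area u v = half_area u v - half_area v u"

lemma area_antisym: "area v u = - area u v"
  by (simp add: area_def)

text \<open>A closed walk of at most four steps either runs around a face or traverses each edge
  equally often in both directions. In the latter case its degree is 0 and, by antisymmetry, so is
  its circulation. The proof enumerates all walks.\<close>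

lemma square_degree_area:
  assumes "a \<in> V" "b \<in> insert a (nbrs a)" "c \<in> insert b (nbrs b)" "d \<in> insert c (nbrs c)"
    "a \<in> insert d (nbrs d)"
  shows "\<bar>8 * square_degree a b c d - (area a b + area b c + area c d + area d a)\<bar> \<le> 1"
proof -
  have d: "d \<in> insert a (nbrs a)"
    using assms(5) nbrs_sym by blast
  have "\<forall>a\<in>{1, 2, 3, 4, 5, 6, 7, 8, 9, 10}. \<forall>b\<in>insert a (nbrs a). \<forall>c\<in>insert b (nbrs b).
    \<forall>d\<in>insert a (nbrs a). d \<in> insert c (nbrs c) \<longrightarrow>
      \<bar>8 * square_degree a b c d - (area a b + area b c + area c d + area d a)\<bar> \<le> 1"
    by (simp only: nbrs_eq ball_simps)
      (simp add: square_degree_def area_def half_area_def del: One_nat_def)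
  moreover have "a \<in> {1, 2, 3, 4, 5, 6, 7, 8, 9, 10}"
    using vertex_cases[OF assms(1)] by simp
  ultimately show ?thesis
    using assms(2-4) d by blast
qed

section \<open>Hypercubes, singular cubes and their degree\<close>

definition hamming :: "'a list \<Rightarrow> 'a list \<Rightarrow> nat" where
  "hamming xs ys = card {i. i < length xs \<and> xs ! i \<noteq> ys ! i}"

lemma hamming_Nil [simp]: "hamming [] ys = 0"
  by (simp add: hamming_def)

text \<open>This recursion lets simplification decide adjacency of explicitly given hypercube
  vertices.\<close>

lemma hamming_Cons [simp]: "hamming (x # xs) (y # ys) = of_bool (x \<noteq> y) + hamming xs ys"
proof -
  let ?S = "{i. i < length xs \<and> xs ! i \<noteq> ys ! i}" and ?T = "if x \<noteq> y then {0 :: nat} else {}"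
  have "{i. i < length (x # xs) \<and> (x # xs) ! i \<noteq> (y # ys) ! i} = ?T \<union> Suc ` ?S"
    by (auto simp: less_Suc_eq_0_disj)
  moreover have "card (?T \<union> Suc ` ?S) = card ?T + card (Suc ` ?S)"
    by (rule card_Un_disjoint) auto
  ultimately show ?thesis
    by (simp add: hamming_def card_image)
qed

lemma hamming_commute: "length xs = length ys \<Longrightarrow> hamming xs ys = hamming ys xs"
  unfolding hamming_def by (rule arg_cong[of _ _ card]) auto

lemma hypercube_edge_iff:
  "{a, b} \<in> edges (hypercube n) \<longleftrightarrow> length a = n \<and> length b = n \<and> hamming a b = 1"
proof -
  define P :: "bool list \<Rightarrow> bool list \<Rightarrow> bool"
    where "P a b \<longleftrightarrow> length a = n \<and> length b = n \<and> card {i. i < n \<and> a ! i \<noteq> b ! i} = 1" for a b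
  have P: "P a b \<longleftrightarrow> length a = n \<and> length b = n \<and> hamming a b = 1" for a b
    unfolding P_def hamming_def by (intro conj_cong refl) (simp only:)
  have "{a, b} \<in> edges (hypercube n) \<longleftrightarrow> (\<exists>a' b'. {a, b} = {a', b'} \<and> P a' b')"
    by (simp add: hypercube_def P_def)
  also have "\<dots> \<longleftrightarrow> P a b \<or> P b a"
    by (auto simp add: doubleton_eq_iff)
  also have "\<dots> \<longleftrightarrow> length a = n \<and> length b = n \<and> hamming a b = 1"
    unfolding P using hamming_commute[of a b] by metis
  finally show ?thesis .
qed

lemma verts_hypercube: "a \<in> verts (hypercube n) \<longleftrightarrow> length a = n"
  by (simp add: hypercube_def)

lemma singular_cube_vertex: "\<sigma> \<in> singular_cubes G n \<Longrightarrow> length a = n \<Longrightarrow> \<sigma> a \<in> verts G"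
  by (auto simp: singular_cubes_def graph_hom_def verts_hypercube)

lemma singular_cube_edge:
  assumes "\<sigma> \<in> singular_cubes example_graph n" "{a, b} \<in> edges (hypercube n)"
  shows "\<sigma> b \<in> insert (\<sigma> a) (nbrs (\<sigma> a))"
proof -
  have "a \<in> verts (hypercube n)" "b \<in> verts (hypercube n)"
    using assms(2) by (simp_all add: hypercube_edge_iff verts_hypercube)
  then have "\<sigma> a = \<sigma> b \<or> \<sigma> b \<in> nbrs (\<sigma> a)"
    using assms unfolding singular_cubes_def graph_hom_def mem_Collect_eq edge_iff by blast
  then show ?thesis
    by auto
qed

text \<open>The corners are read off in cyclic order around the square, not in lexicographic order;
  \<open>square_cube\<close> follows the same convention.\<close>

definition cube_degree :: "(bool list \<Rightarrow> nat) \<Rightarrow> int" where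
  "cube_degree \<sigma> =
    square_degree (\<sigma> [False, False]) (\<sigma> [True, False]) (\<sigma> [True, True]) (\<sigma> [False, True])"

lemma cube_face_apply: "length a = n - 1 \<Longrightarrow> cube_face n i \<epsilon> \<sigma> a = \<sigma> (take (i - 1) a @ \<epsilon> # drop (i - 1) a)"
  by (simp add: cube_face_def verts_hypercube)

lemma cube_boundary_2:
  "cube_boundary 2 \<sigma> =
    Poly_Mapping.single (cube_face 2 1 True \<sigma>) 1 - Poly_Mapping.single (cube_face 2 1 False \<sigma>) 1
    + Poly_Mapping.single (cube_face 2 2 False \<sigma>) 1 - Poly_Mapping.single (cube_face 2 2 True \<sigma>) 1"
  by (simp add: cube_boundary_def numeral_2_eq_2 pm_scale_minus_one)

lemma cube_boundary_3:
  "cube_boundary 3 \<sigma> =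
    Poly_Mapping.single (cube_face 3 1 True \<sigma>) 1 - Poly_Mapping.single (cube_face 3 1 False \<sigma>) 1
    + Poly_Mapping.single (cube_face 3 2 False \<sigma>) 1 - Poly_Mapping.single (cube_face 3 2 True \<sigma>) 1
    + Poly_Mapping.single (cube_face 3 3 True \<sigma>) 1 - Poly_Mapping.single (cube_face 3 3 False \<sigma>) 1"
  by (simp add: cube_boundary_def numeral_3_eq_3 numeral_2_eq_2 pm_scale_minus_one)

lemma alternating_sum_zero:
  fixes d1 :: int
  assumes "\<bar>8 * d1 - w1\<bar> \<le> 1" "\<bar>8 * d2 - w2\<bar> \<le> 1" "\<bar>8 * d3 - w3\<bar> \<le> 1"
    "\<bar>8 * d4 - w4\<bar> \<le> 1" "\<bar>8 * d5 - w5\<bar> \<le> 1" "\<bar>8 * d6 - w6\<bar> \<le> 1"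
    and "w1 - w2 + w3 - w4 + w5 - w6 = 0"
  shows "d1 - d2 + d3 - d4 + d5 - d6 = 0"
proof -
  have "8 * (d1 - d2 + d3 - d4 + d5 - d6) = (8 * d1 - w1) - (8 * d2 - w2) + (8 * d3 - w3)
      - (8 * d4 - w4) + (8 * d5 - w5) - (8 * d6 - w6)"
    using assms(7) by simp
  then have "\<bar>8 * (d1 - d2 + d3 - d4 + d5 - d6)\<bar> \<le> 6"
    using assms(1-6) unfolding abs_le_iff by linarith
  then show ?thesis
    by presburger
qed

lemma cube_degree_boundary:
  assumes "\<sigma> \<in> singular_cubes example_graph 3"
  shows "cube_degree (cube_face 3 1 True \<sigma>) - cube_degree (cube_face 3 1 False \<sigma>)
    + cube_degree (cube_face 3 2 False \<sigma>) - cube_degree (cube_face 3 2 True \<sigma>)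
    + cube_degree (cube_face 3 3 True \<sigma>) - cube_degree (cube_face 3 3 False \<sigma>) = 0"
proof -
  define s where "s x y z = \<sigma> [x, y, z]" for x y z
  have V: "s x y z \<in> V" for x y z
    using singular_cube_vertex[OF assms] by (simp add: s_def)
  have step: "s x' y' z' \<in> insert (s x y z) (nbrs (s x y z))"
    if "of_bool (x \<noteq> x') + of_bool (y \<noteq> y') + of_bool (z \<noteq> z') = (1 :: nat)" for x y z x' y' z'
    unfolding s_def using that by (intro singular_cube_edge[OF assms]) (simp add: hypercube_edge_iff)
  define w where "w a b c d = area a b + area b c + area c d + area d a" for a b c d
  have face: "cube_degree (cube_face 3 1 \<epsilon> \<sigma>) =
      square_degree (s \<epsilon> False False) (s \<epsilon> True False) (s \<epsilon> True True) (s \<epsilon> False True)"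
    "cube_degree (cube_face 3 2 \<epsilon> \<sigma>) =
      square_degree (s False \<epsilon> False) (s True \<epsilon> False) (s True \<epsilon> True) (s False \<epsilon> True)"
    "cube_degree (cube_face 3 3 \<epsilon> \<sigma>) =
      square_degree (s False False \<epsilon>) (s True False \<epsilon>) (s True True \<epsilon>) (s False True \<epsilon>)" for \<epsilon>
    by (simp_all add: cube_degree_def cube_face_apply s_def numeral_3_eq_3)
  have "\<bar>8 * cube_degree (cube_face 3 1 \<epsilon> \<sigma>) -
      w (s \<epsilon> False False) (s \<epsilon> True False) (s \<epsilon> True True) (s \<epsilon> False True)\<bar> \<le> 1"
    "\<bar>8 * cube_degree (cube_face 3 2 \<epsilon> \<sigma>) -
      w (s False \<epsilon> False) (s True \<epsilon> False) (s True \<epsilon> True) (s False \<epsilon> True)\<bar> \<le> 1"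
    "\<bar>8 * cube_degree (cube_face 3 3 \<epsilon> \<sigma>) -
      w (s False False \<epsilon>) (s True False \<epsilon>) (s True True \<epsilon>) (s False True \<epsilon>)\<bar> \<le> 1" for \<epsilon>
    unfolding face w_def by (intro square_degree_area V step; simp)+
  note bounds = this[of True] this[of False]
  \<comment> \<open>Each edge of the cube lies on two faces, whose signed orientations traverse it
    in opposite directions. The twelve instances of \<open>area_antisym\<close>, one per edge, make
    the terms cancel.\<close>
  have "w (s True False False) (s True True False) (s True True True) (s True False True)
    - w (s False False False) (s False True False) (s False True True) (s False False True)
    + w (s False False False) (s True False False) (s True False True) (s False False True)
    - w (s False True False) (s True True False) (s True True True) (s False True True)
    + w (s False False True) (s True False True) (s True True True) (s False True True)
    - w (s False False False) (s True False False) (s True True False) (s False True False) = 0"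
    by (simp add: w_def
        area_antisym[of "s False False False" "s True False False"]
        area_antisym[of "s False False False" "s False True False"]
        area_antisym[of "s False False False" "s False False True"]
        area_antisym[of "s True False False" "s True True False"]
        area_antisym[of "s True False False" "s True False True"]
        area_antisym[of "s False True False" "s True True False"]
        area_antisym[of "s False True False" "s False True True"]
        area_antisym[of "s False False True" "s True False True"]
        area_antisym[of "s False False True" "s False True True"]
        area_antisym[of "s True True False" "s True True True"]
        area_antisym[of "s True False True" "s True True True"]
        area_antisym[of "s False True True" "s True True True"])
  then show ?thesis
    \<comment> \<open>The facts in \<open>bounds\<close> list the three True faces and then the
      three False faces; the permutation matches the signs of
      \<open>cube_boundary_3\<close>.\<close>
    by (rule alternating_sum_zero[OF bounds(1,4,5,2,3,6)])
qed

text \<open>The target is a copy of the coefficient ring, presented as chains on one point so that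
  the results on \<open>linear_extension\<close> apply.\<close>

definition degree_map :: "((bool list \<Rightarrow> nat) \<Rightarrow>\<^sub>0 'r::comm_ring_1) \<Rightarrow> (unit \<Rightarrow>\<^sub>0 'r)" where
  "degree_map = linear_extension (\<lambda>\<sigma>. Poly_Mapping.single () (of_int (cube_degree \<sigma>)))"

text \<open>With the empty set as target, \<open>linear_extension_supported\<close> says that a
  linear map vanishing on the basis elements vanishes.\<close>

lemma supported_empty: "x \<in> supported {} \<longleftrightarrow> x = 0"
  by (simp add: supported_def)

lemma degree_map_boundary:
  assumes "x \<in> supported (singular_cubes example_graph 3)"
  shows "degree_map (linear_extension (cube_boundary 3) x :: _ \<Rightarrow>\<^sub>0 'r::comm_ring_1) = 0"
proof -
  let ?g = "\<lambda>\<sigma>. Poly_Mapping.single () (of_int (cube_degree \<sigma>) :: 'r)"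
  have "linear_extension ?g (cube_boundary 3 \<sigma>) = 0" if "\<sigma> \<in> singular_cubes example_graph 3" for \<sigma>
    using arg_cong[OF cube_degree_boundary[OF that], of "\<lambda>k. Poly_Mapping.single () (of_int k :: 'r)"]
    by (simp add: cube_boundary_3 linear_extension_add linear_extension_diff single_add single_diff)
  then have "linear_extension (\<lambda>\<sigma>. linear_extension ?g (cube_boundary 3 \<sigma>)) x \<in> supported {}"
    by (intro linear_extension_supported[OF assms]) (simp add: supported_empty)
  then show ?thesis
    by (simp add: degree_map_def linear_extension_linear_extension supported_empty)
qed

text \<open>Equal opposite faces force two neighbouring corners to coincide, whereas the quadruples
  of nonzero degree have four distinct entries.\<close>

lemma cube_degree_degenerate:
  assumes "\<sigma> \<in> degenerate_cubes G 2"
  shows "cube_degree \<sigma> = 0"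
proof -
  obtain i where i: "i \<in> {1..2}" and eq: "cube_face 2 i True \<sigma> = cube_face 2 i False \<sigma>"
    using assms by (auto simp: degenerate_cubes_def)
  have "\<sigma> (take (i - 1) [x] @ True # drop (i - 1) [x]) = \<sigma> (take (i - 1) [x] @ False # drop (i - 1) [x])" for x
    using fun_cong[OF eq, of "[x]"] by (simp add: cube_face_apply)
  note * = this[of True] this[of False]
  have "i = 1 \<or> i = 2"
    using i by auto
  then show ?thesis
    using * by (elim disjE) (auto simp: cube_degree_def square_degree_def)
qed

lemma degree_map_degenerate:
  assumes "x \<in> supported (degenerate_cubes G 2)"
  shows "degree_map x = 0"
proof -
  have "degree_map x \<in> supported {}"
    unfolding degree_map_def
    by (rule linear_extension_supported[OF assms]) (simp add: cube_degree_degenerate)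
  then show ?thesis
    by (simp add: supported_empty)
qed

section \<open>The sphere as a cubical cycle\<close>

definition edge_cube :: "'v \<Rightarrow> 'v \<Rightarrow> bool list \<Rightarrow> 'v" where
  "edge_cube u v = restrict (\<lambda>a. if a = [True] then v else u) (verts (hypercube 1))"

definition square_cube :: "'v \<Rightarrow> 'v \<Rightarrow> 'v \<Rightarrow> 'v \<Rightarrow> bool list \<Rightarrow> 'v" where
  "square_cube a b c d = restrict (\<lambda>p. if p = [False, False] then a else if p = [True, False] then b
     else if p = [True, True] then c else d) (verts (hypercube 2))"

lemma edge_cubeI:
  assumes "\<And>a. length a \<noteq> 1 \<Longrightarrow> f a = undefined"
  shows "f = edge_cube (f [False]) (f [True])"
proof
  fix a
  show "f a = edge_cube (f [False]) (f [True]) a"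
  proof (cases "length a = 1")
    case True
    then obtain x where "a = [x]"
      by (auto simp: length_Suc_conv)
    then show ?thesis
      by (cases x) (simp_all add: edge_cube_def verts_hypercube)
  next
    case False
    then show ?thesis
      using assms[of a] by (simp add: edge_cube_def verts_hypercube)
  qed
qed

text \<open>Once faces are written as \<open>edge_cube\<close> terms, faces of different squares are
  visibly equal when their end points agree, and boundaries cancel by simplification.\<close>

lemma cube_face_2:
  "cube_face 2 1 \<epsilon> \<sigma> = edge_cube (\<sigma> [\<epsilon>, False]) (\<sigma> [\<epsilon>, True])"
  "cube_face 2 2 \<epsilon> \<sigma> = edge_cube (\<sigma> [False, \<epsilon>]) (\<sigma> [True, \<epsilon>])"
proof -
  have "cube_face 2 i \<epsilon> \<sigma> = edge_cube (cube_face 2 i \<epsilon> \<sigma> [False]) (cube_face 2 i \<epsilon> \<sigma> [True])" for i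
    by (rule edge_cubeI) (simp add: cube_face_def verts_hypercube)
  from this[of 1] this[of 2] show
    "cube_face 2 1 \<epsilon> \<sigma> = edge_cube (\<sigma> [\<epsilon>, False]) (\<sigma> [\<epsilon>, True])"
    "cube_face 2 2 \<epsilon> \<sigma> = edge_cube (\<sigma> [False, \<epsilon>]) (\<sigma> [True, \<epsilon>])"
    by (simp_all add: cube_face_apply)
qed

lemma edge_cube_apply: "edge_cube u v [x] = (if x then v else u)"
  by (simp add: edge_cube_def verts_hypercube)

lemma edge_cube_degenerate:
  assumes "v \<in> verts G"
  shows "edge_cube v v \<in> degenerate_cubes G 1"
proof -
  have "edge_cube v v \<in> singular_cubes G 1"
    using assms by (auto simp: singular_cubes_def graph_hom_def edge_cube_def verts_hypercube)
  moreover have "cube_face 1 1 True (edge_cube v v) = cube_face 1 1 False (edge_cube v v)"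
    by (auto simp: cube_face_def restrict_def verts_hypercube edge_cube_apply fun_eq_iff)
  ultimately show ?thesis
    by (auto simp: degenerate_cubes_def)
qed

text \<open>The two equal faces cancel, and the other two are constant edges.\<close>

lemma cube_boundary_2_degenerate:
  assumes "\<sigma> \<in> degenerate_cubes G 2"
  shows "cube_boundary 2 \<sigma> \<in> supported (degenerate_cubes G 1)"
proof -
  have V: "\<sigma> [x, y] \<in> verts G" for x y
    using assms by (auto simp: degenerate_cubes_def intro!: singular_cube_vertex)
  obtain i where "i \<in> {1..2}" and eq: "cube_face 2 i True \<sigma> = cube_face 2 i False \<sigma>"
    using assms by (auto simp: degenerate_cubes_def)
  then consider "i = 1" | "i = 2"
    by fastforce
  then show ?thesis
  proof cases
    case 1
    have "\<sigma> [True, y] = \<sigma> [False, y]" for y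
      using fun_cong[OF eq, of "[y]"] 1 by (simp add: cube_face_apply)
    then show ?thesis
      unfolding cube_boundary_2 cube_face_2
      by (simp add: supported_diff edge_cube_degenerate[OF V] del: One_nat_def)
  next
    case 2
    have "\<sigma> [y, True] = \<sigma> [y, False]" for y
      using fun_cong[OF eq, of "[y]"] 2 by (simp add: cube_face_apply)
    then show ?thesis
      unfolding cube_boundary_2 cube_face_2
      by (simp add: supported_diff edge_cube_degenerate[OF V] del: One_nat_def)
  qed
qed

lemma square_cube_apply:
  "square_cube a b c d [x, y] = (if x then if y then c else b else if y then d else a)"
  by (simp add: square_cube_def verts_hypercube)

lemma cube_boundary_square:
  "cube_boundary 2 (square_cube a b c d) =
    Poly_Mapping.single (edge_cube b c) 1 - Poly_Mapping.single (edge_cube a d) 1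
    + Poly_Mapping.single (edge_cube a b) 1 - Poly_Mapping.single (edge_cube d c) 1"
  unfolding cube_boundary_2 cube_face_2 by (simp add: square_cube_apply)

lemma square_cube_singular:
  assumes "b \<in> nbrs a" "c \<in> nbrs b" "d \<in> nbrs c" "a \<in> nbrs d"
  shows "square_cube a b c d \<in> singular_cubes example_graph 2"
proof -
  have V: "a \<in> V" "b \<in> V" "c \<in> V" "d \<in> V"
    using assms nbrs_verts by blast+
  have sym: "d \<in> nbrs a" "a \<in> nbrs b" "b \<in> nbrs c" "c \<in> nbrs d"
    using assms nbrs_sym by blast+
  have "square_cube a b c d p \<in> V" if "length p = 2" for p
    using that V by (auto simp: square_cube_apply length_2_iff)
  moreover have "square_cube a b c d p = square_cube a b c d q \<or>
      square_cube a b c d q \<in> nbrs (square_cube a b c d p)"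
    if pq_edge: "{p, q} \<in> edges (hypercube 2)" for p q
  proof -
    obtain x y x' y' where pq: "p = [x, y]" "q = [x', y']"
      using pq_edge by (auto simp: hypercube_edge_iff length_2_iff)
    show ?thesis
      using pq_edge assms sym unfolding pq hypercube_edge_iff
      by (cases x; cases y; cases x'; cases y') (simp_all add: square_cube_apply)
  qed
  ultimately show ?thesis
    by (auto simp: singular_cubes_def graph_hom_def edge_iff verts_hypercube)
      (simp_all add: square_cube_def)
qed

text \<open>In the cubical complex \<open>edge_cube u v\<close> and \<open>edge_cube v u\<close> are
  different basis elements, not negatives of each other. Every square therefore starts at its least
  vertex and ascends on both sides, so that neighbouring squares share the same edge cube with
  opposite signs and the boundary vanishes already in the free module.\<close>

definition sphere :: "(bool list \<Rightarrow> nat) \<Rightarrow>\<^sub>0 'r::comm_ring_1" where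
  "sphere =
    Poly_Mapping.single (square_cube 1 2 6 3) 1 + Poly_Mapping.single (square_cube 1 3 8 5) 1 +
    Poly_Mapping.single (square_cube 1 5 9 4) 1 + Poly_Mapping.single (square_cube 1 4 7 2) 1 +
    Poly_Mapping.single (square_cube 2 7 10 6) 1 + Poly_Mapping.single (square_cube 3 6 10 8) 1 +
    Poly_Mapping.single (square_cube 5 8 10 9) 1 + Poly_Mapping.single (square_cube 4 9 10 7) 1"

lemma sphere_singular: "sphere \<in> supported (singular_cubes example_graph 2)"
  unfolding sphere_def
  by (intro supported_add) (simp_all add: square_cube_singular nbrs_eq del: One_nat_def)

lemma sphere_boundary: "linear_extension (cube_boundary 2) sphere = 0"
  by (simp add: sphere_def linear_extension_add cube_boundary_square del: One_nat_def)

lemma degree_map_sphere: "degree_map sphere = Poly_Mapping.single () 1"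
  by (simp add: sphere_def degree_map_def linear_extension_add cube_degree_def square_cube_apply
      square_degree_def del: One_nat_def)

lemma cube_homology_2_nonzero:
  "\<not> cube_homology TYPE('r::comm_ring_1) example_graph 2 \<cong>\<^sub>M (zero_module :: ('r, unit) module)"
proof
  assume iso: "cube_homology TYPE('r) example_graph 2 \<cong>\<^sub>M (zero_module :: ('r, unit) module)"
  let ?G = "example_graph"
  let ?D = "\<lambda>n. supported (degenerate_cubes ?G n) :: ((bool list \<Rightarrow> nat) \<Rightarrow>\<^sub>0 'r) set"
  let ?C = "cube_chains ?G :: nat \<Rightarrow> ('r, ((bool list \<Rightarrow> nat) \<Rightarrow>\<^sub>0 'r) set) module"
  let ?Z = "cycles ?C (cube_chain_boundary ?G) 2"
  let ?B = "boundaries ?C (cube_chain_boundary ?G) 2"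
  have D: "degenerate_cube_chains ?G n = ?D n" for n
    by (simp add: degenerate_cube_chains_def carrier_free_module)
  have C: "carrier (?C n) = coset (?D n) ` supported (singular_cubes ?G n)" for n
    by (simp add: cube_chains_def quotient_module_carrier D)
  have cycle: "coset (?D 2) x \<in> ?Z"
    if "x \<in> supported (singular_cubes ?G 2)" "linear_extension (cube_boundary 2) x = 0" for x
  proof -
    have "quotient_map (free_module (singular_cubes ?G (2 - 1))) (?D (2 - 1))
        (linear_extension (cube_boundary 2)) (coset (?D 2) x) =
        coset (?D (2 - 1)) (linear_extension (cube_boundary 2) x)"
      by (rule quotient_map_coset) (use cube_boundary_2_degenerate in simp)
    then have "cube_chain_boundary ?G 2 (coset (?D 2) x) = ?D (2 - 1)"
      by (simp only: cube_chain_boundary_def D coset_0 that(2))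
    moreover have "\<zero>\<^bsub>?C (2 - 1)\<^esub> = ?D (2 - 1)"
      by (simp only: cube_chains_def zero_quotient_module D)
    ultimately show ?thesis
      using that(1) by (simp only: cycles_def C mem_Collect_eq) blast
  qed
  \<comment> \<open>A boundary class is a set of chains. The degree is evaluated on all its members,
    so it never has to be defined on the quotient.\<close>
  have B: "degree_map h = 0" if bB: "b \<in> ?B" and hb: "h \<in> b" for b h
  proof -
    have three: "Suc 2 = 3" "3 - 1 = (2 :: nat)"
      by simp_all
    obtain y where y: "y \<in> supported (singular_cubes ?G 3)" "b = cube_chain_boundary ?G 3 (coset (?D 3) y)"
      using bB unfolding boundaries_def three C by blast
    then obtain t where t: "t \<in> coset (?D 3) y" "h \<in> coset (?D 2) (linear_extension (cube_boundary 3) t)"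
      using hb unfolding y(2) cube_chain_boundary_def quotient_map_def r_coset_free_module D three by blast
    \<comment> \<open>The union in \<open>quotient_map\<close> runs over all representatives
      \<open>t\<close> of the class of \<open>y\<close>. They differ from \<open>y\<close> by
      degenerate cubes, which are singular, so \<open>degree_map_boundary\<close> applies to
      \<open>t\<close>.\<close>
    have "degenerate_cubes ?G 3 \<subseteq> singular_cubes ?G 3"
      by (auto simp: degenerate_cubes_def)
    then have "t - y \<in> supported (singular_cubes ?G 3)"
      using t(1) by (auto simp: coset_def supported_def)
    then have "t \<in> supported (singular_cubes ?G 3)"
      using supported_add[OF _ y(1)] by fastforce
    then have "degree_map (linear_extension (cube_boundary 3) t) = 0"
      by (rule degree_map_boundary)
    moreover have "degree_map (h - linear_extension (cube_boundary 3) t) = 0"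
      using t(2) by (intro degree_map_degenerate[of _ ?G]) (simp add: coset_def)
    ultimately show ?thesis
      by (simp add: degree_map_def linear_extension_diff)
  qed
  have add: "X \<oplus>\<^bsub>?C 2\<^esub> Y = {h + k | h k. h \<in> X \<and> k \<in> Y}" for X Y
    by (auto simp: cube_chains_def quotient_module_def set_add_def' free_module_def)
  \<comment> \<open>The boundary of the zero class; it provides a boundary known to contain the
    chain 0.\<close>
  define b where "b = cube_chain_boundary ?G 3 (coset (?D 3) 0)"
  have three: "Suc 2 = 3" "3 - 1 = (2 :: nat)"
    by simp_all
  have b: "b \<in> ?B"
    unfolding b_def boundaries_def three C by (intro imageI) simp
  have "0 \<in> b"
    unfolding b_def cube_chain_boundary_def quotient_map_def r_coset_free_module D three
    by (rule UN_I[of 0]) (simp_all add: coset_def)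
  have "(\<lambda>b. b \<oplus>\<^bsub>?C 2\<^esub> X) ` ?B \<in> carrier (cube_homology TYPE('r) ?G 2)" if "X \<in> ?Z" for X
    unfolding cube_homology_def carrier_homology by (rule imageI[OF that])
  \<comment> \<open>Trivial homology identifies the classes of \<open>sphere\<close> and 0.
    Comparing members writes \<open>sphere\<close> as a member of a boundary class plus a degenerate
    chain, both of degree 0, against \<open>degree_map_sphere\<close>.\<close>
  then have "(\<lambda>b. b \<oplus>\<^bsub>?C 2\<^esub> coset (?D 2) sphere) ` ?B = (\<lambda>b. b \<oplus>\<^bsub>?C 2\<^esub> coset (?D 2) 0) ` ?B"
    using isomorphic_zero_carrier_unique[OF iso] cycle[OF sphere_singular sphere_boundary] cycle[of 0]
    by simp
  then obtain b' where b': "b' \<in> ?B" "b \<oplus>\<^bsub>?C 2\<^esub> coset (?D 2) sphere = b' \<oplus>\<^bsub>?C 2\<^esub> coset (?D 2) 0"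
    using b by blast
  have "0 + sphere \<in> b \<oplus>\<^bsub>?C 2\<^esub> coset (?D 2) sphere"
    unfolding add using \<open>0 \<in> b\<close> by (intro CollectI exI[of _ 0] exI[of _ sphere]) simp
  then obtain h k where hk: "sphere = h + k" "h \<in> b'" "k \<in> ?D 2"
    unfolding b'(2) unfolding add by (auto simp: coset_0)
  have "degree_map (sphere :: (bool list \<Rightarrow> nat) \<Rightarrow>\<^sub>0 'r) = degree_map h + degree_map k"
    unfolding hk(1) by (simp add: degree_map_def linear_extension_add)
  also have "\<dots> = 0"
    using B[OF b'(1) hk(2)] degree_map_degenerate[OF hk(3)] by simp
  finally have "Poly_Mapping.lookup (Poly_Mapping.single () (1 :: 'r)) () = Poly_Mapping.lookup 0 ()"
    unfolding degree_map_sphere by (rule arg_cong)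
  then show False
    by simp
qed

theorem theorem6p1:
  shows "path_homology TYPE('r::comm_ring_1) example_graph 2 \<cong>\<^sub>M (zero_module :: ('r, unit) module) \<and>
    \<not> cube_homology TYPE('r) example_graph 2 \<cong>\<^sub>M (zero_module :: ('r, unit) module)"
  using path_homology_2_zero cube_homology_2_nonzero by blast

end
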